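(* \textsc{Labeled Contractibility} (given two uniquely vertex-labeled graphs $G$ and $H$ with $V(H)\subseteq V(G)$, decide whether $H$ is a labeled contraction of $G$) can be solved in time $(\delta(H)+1)^k \cdot |V(G)|^{\mathcal{O}(1)}$, where $k = |V(G)\setminus V(H)|$ and $\delta(H)$ is the degeneracy of $H$.
   Context: Graphs are simple, finite, undirected, and uniquely labeled: vertices are identified with their labels, and two labeled graphs are equal iff they have the same vertex set and the same edge set. For an edge $(u,v)$ of a labeled graph $G$, the labeled contraction $G/(u,v)$ is obtained by adding an edge $(u,w)$ for every $w \in N(v)\setminus N[u]$ and then deleting $v$ with all its incident edges. $H$ is a labeled contraction of $G$ if some sequence of such contractions, each applied to an edge of the current graph, transforms $G$ into a graph equal to $H$. The degeneracy of a graph is the smallest integer $d$ such that every subgraph has a vertex of degree at most $d$. *)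

theory Defs
  imports Main "HOL-Computational_Algebra.Polynomial"
begin

section \<open>Labeled graphs\<close>

text \<open>
  Equality of this datatype is equality of labeled graphs: same vertex set and same edge set.
  An undirected edge is the two-element set of its endpoints.
\<close>

datatype 'a graph = Graph (verts: "'a set") (edges: "'a set set")

definition simple_graph :: "'a graph \<Rightarrow> bool" where
  "simple_graph G \<longleftrightarrow> finite (verts G) \<and> (\<forall>e \<in> edges G. e \<subseteq> verts G \<and> card e = 2)"

definition nbrs :: "'a graph \<Rightarrow> 'a \<Rightarrow> 'a set" where
  "nbrs G v = {w. {v, w} \<in> edges G}"

definition vertex_degree :: "'a graph \<Rightarrow> 'a \<Rightarrow> nat" where
  "vertex_degree G v = card (nbrs G v)"

definition subgraph :: "'a graph \<Rightarrow> 'a graph \<Rightarrow> bool" where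
  "subgraph S G \<longleftrightarrow> simple_graph S \<and> verts S \<subseteq> verts G \<and> edges S \<subseteq> edges G"

text \<open>
  Subgraphs are taken to be non-empty here, as the empty one has no vertex at all; the
  degeneracy of the empty graph is thus 0.
\<close>

definition degeneracy :: "'a graph \<Rightarrow> nat" where
  "degeneracy G =
     (LEAST d. \<forall>S. subgraph S G \<and> verts S \<noteq> {} \<longrightarrow> (\<exists>v \<in> verts S. vertex_degree S v \<le> d))"


section \<open>Labeled contractions\<close>

definition add_edges :: "'a set set \<Rightarrow> 'a graph \<Rightarrow> 'a graph" where
  "add_edges F G = Graph (verts G) (edges G \<union> F)"

definition delete_vertex :: "'a \<Rightarrow> 'a graph \<Rightarrow> 'a graph" where
  "delete_vertex v G = Graph (verts G - {v}) {e \<in> edges G. v \<notin> e}"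

text \<open>The operation is not symmetric: in \<open>contract G u v\<close> the label \<open>u\<close> survives.\<close>

definition contract :: "'a graph \<Rightarrow> 'a \<Rightarrow> 'a \<Rightarrow> 'a graph" where
  "contract G u v =
     delete_vertex v (add_edges {{u, w} |w. w \<in> nbrs G v - insert u (nbrs G u)} G)"

definition contraction_step :: "'a graph \<Rightarrow> 'a graph \<Rightarrow> bool" where
  "contraction_step G G' \<longleftrightarrow> (\<exists>u v. {u, v} \<in> edges G \<and> G' = contract G u v)"

definition labeled_contraction_of :: "'a graph \<Rightarrow> 'a graph \<Rightarrow> bool" where
  "labeled_contraction_of H G \<longleftrightarrow> contraction_step\<^sup>*\<^sup>* G H"


section \<open>Machine model\<close>

text \<open>
  Running time is measured on a random access machine programmed with structured control flow.
  The memory consists of named arrays of natural numbers (a program mentions only finitely many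
  of them; a scalar register is cell 0 of an array).  Every operation, memory access and test
  costs one unit.  The only arithmetic operations are addition and truncated subtraction: without
  multiplication or shifts the bit length of the numbers in memory grows by at most one per
  operation, so that unit cost is polynomially related to Turing machine time.
\<close>

datatype aexp =
    Const nat
  | Read string aexp
  | Plus aexp aexp
  | Minus aexp aexp

datatype bexp =
    Less aexp aexp
  | Equal aexp aexp
  | Neg bexp
  | Conj bexp bexp

datatype com =
    Skip
  | Write string aexp aexp
  | Seq com com
  | Ite bexp com com
  | While bexp com

type_synonym memory = "string \<Rightarrow> nat \<Rightarrow> nat"

fun aval :: "aexp \<Rightarrow> memory \<Rightarrow> nat" where
  "aval (Const n) s = n"
| "aval (Read x a) s = s x (aval a s)"
| "aval (Plus a b) s = aval a s + aval b s"
| "aval (Minus a b) s = aval a s - aval b s"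

fun bval :: "bexp \<Rightarrow> memory \<Rightarrow> bool" where
  "bval (Less a b) s \<longleftrightarrow> aval a s < aval b s"
| "bval (Equal a b) s \<longleftrightarrow> aval a s = aval b s"
| "bval (Neg b) s \<longleftrightarrow> \<not> bval b s"
| "bval (Conj b c) s \<longleftrightarrow> bval b s \<and> bval c s"

fun acost :: "aexp \<Rightarrow> nat" where
  "acost (Const n) = 1"
| "acost (Read x a) = 1 + acost a"
| "acost (Plus a b) = 1 + acost a + acost b"
| "acost (Minus a b) = 1 + acost a + acost b"

fun bcost :: "bexp \<Rightarrow> nat" where
  "bcost (Less a b) = 1 + acost a + acost b"
| "bcost (Equal a b) = 1 + acost a + acost b"
| "bcost (Neg b) = 1 + bcost b"
| "bcost (Conj b c) = 1 + bcost b + bcost c"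

text \<open>\<open>exec c s t s'\<close>: started in memory \<open>s\<close>, \<open>c\<close> halts after \<open>t\<close> units of time in memory \<open>s'\<close>.\<close>

inductive exec :: "com \<Rightarrow> memory \<Rightarrow> nat \<Rightarrow> memory \<Rightarrow> bool" where
  Skip: "exec Skip s 1 s"
| Write: "exec (Write x a b) s (1 + acost a + acost b)
            (s(x := (s x)(aval a s := aval b s)))"
| Seq: "exec c1 s1 t1 s2 \<Longrightarrow> exec c2 s2 t2 s3 \<Longrightarrow> exec (Seq c1 c2) s1 (t1 + t2) s3"
| IfTrue: "bval b s \<Longrightarrow> exec c1 s t s' \<Longrightarrow> exec (Ite b c1 c2) s (1 + bcost b + t) s'"
| IfFalse: "\<not> bval b s \<Longrightarrow> exec c2 s t s' \<Longrightarrow> exec (Ite b c1 c2) s (1 + bcost b + t) s'"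
| WhileFalse: "\<not> bval b s \<Longrightarrow> exec (While b c) s (1 + bcost b) s"
| WhileTrue: "bval b s1 \<Longrightarrow> exec c s1 t1 s2 \<Longrightarrow> exec (While b c) s2 t2 s3 \<Longrightarrow>
                exec (While b c) s1 (1 + bcost b + t1 + t2) s3"

inductive_cases SkipE: "exec Skip s t s'"
inductive_cases WriteE: "exec (Write x a b) s t s'"
inductive_cases SeqE: "exec (Seq c1 c2) s t s'"
inductive_cases IfE: "exec (Ite b c1 c2) s t s'"
inductive_cases WhileE: "exec (While b c) s t s'"

lemma exec_deterministic:
  "exec c s t s' \<Longrightarrow> exec c s u s'' \<Longrightarrow> t = u \<and> s' = s''"
proof (induction arbitrary: u s'' rule: exec.induct)
  case Skip
  then show ?case by (rule SkipE) simp
next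
  case Write
  then show ?case by (rule WriteE) simp
next
  case Seq
  from Seq.prems show ?case by (rule SeqE) (metis Seq.IH)
next
  case IfTrue
  from IfTrue.prems show ?case by (rule IfE) (auto simp: IfTrue.hyps(1) dest!: IfTrue.IH)
next
  case IfFalse
  from IfFalse.prems show ?case by (rule IfE) (auto simp: IfFalse.hyps(1) dest!: IfFalse.IH)
next
  case WhileFalse
  from WhileFalse.prems show ?case by (rule WhileE) (auto simp: WhileFalse.hyps(1))
next
  case WhileTrue
  from WhileTrue.prems show ?case by (rule WhileE) (auto simp: WhileTrue.hyps(1) dest!: WhileTrue.IH)
qed

text \<open>
  The input word is stored in array \<open>in\<close>, all other cells being 0; the answer (1 for yes, 0 for
  no) is left in cell 0 of array \<open>out\<close>.
\<close>

definition input_memory :: "nat list \<Rightarrow> memory" where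
  "input_memory xs = (\<lambda>x i. if x = ''in'' \<and> i < length xs then xs ! i else 0)"

definition answers_within :: "com \<Rightarrow> nat list \<Rightarrow> bool \<Rightarrow> nat \<Rightarrow> bool" where
  "answers_within p xs ans T \<longleftrightarrow>
     (\<exists>t s. exec p (input_memory xs) t s \<and> s ''out'' 0 = of_bool ans \<and> t \<le> T)"


section \<open>Encoding of instances\<close>

text \<open>
  Labels are natural numbers, of arbitrary size relative to the number of vertices.  A graph is
  written as number of vertices, number of edges, list of vertices, list of edges, where the
  vertices, the edges and the two endpoints of each edge may come in any order, but nothing is
  listed twice (so an encoding has length polynomial in the number of vertices).
\<close>

definition encodes_graph :: "nat list \<Rightarrow> nat graph \<Rightarrow> bool" where
  "encodes_graph xs G \<longleftrightarrow>
     (\<exists>vs es. distinct vs \<and> set vs = verts G \<and>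
        distinct (map (\<lambda>(u, v). {u, v}) es) \<and> set (map (\<lambda>(u, v). {u, v}) es) = edges G \<and>
        xs = length vs # length es # vs @ concat (map (\<lambda>(u, v). [u, v]) es))"

definition encodes_instance :: "nat list \<Rightarrow> nat graph \<Rightarrow> nat graph \<Rightarrow> bool" where
  "encodes_instance xs G H \<longleftrightarrow> (\<exists>ys zs. encodes_graph ys G \<and> encodes_graph zs H \<and> xs = ys @ zs)"

lemma encodes_graph_exists:
  assumes "simple_graph G"
  shows "\<exists>xs. encodes_graph xs G"
proof -
  from assms have fin: "finite (verts G)" and "edges G \<subseteq> Pow (verts G)"
    by (auto simp: simple_graph_def)
  then have "finite (edges G)"
    by (meson finite_Pow_iff finite_subset)
  then obtain fs where fs: "distinct fs" "set fs = edges G"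
    using finite_distinct_list by blast
  obtain vs where vs: "distinct vs" "set vs = verts G"
    using fin finite_distinct_list by blast
  have "\<forall>e \<in> edges G. \<exists>p. (case p of (u, v) \<Rightarrow> {u, v}) = e"
    using assms by (fastforce simp: simple_graph_def card_2_iff)
  then obtain f where f: "\<And>e. e \<in> edges G \<Longrightarrow> (case f e of (u, v) \<Rightarrow> {u, v}) = e"
    by metis
  have "map (\<lambda>(u, v). {u, v}) (map f fs) = fs"
    using f fs(2) by (auto intro: map_idI)
  then have "encodes_graph (length vs # length (map f fs) # vs @
      concat (map (\<lambda>(u, v). [u, v]) (map f fs))) G"
    unfolding encodes_graph_def
    by (intro exI[of _ vs] exI[of _ "map f fs"] conjI refl) (simp_all only: vs fs)
  then show ?thesis ..
qed

end

theory Submission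
  imports Defs
begin

text \<open>
  A graph \<open>H\<close> is a labeled contraction of \<open>G\<close> iff the vertices of \<open>G\<close> can be partitioned into connected
  classes, one around each vertex of \<open>H\<close>, such that the quotient graph is \<open>H\<close>.  Order the vertices of
  \<open>H\<close> as \<open>h\<^sub>0, h\<^sub>1, \<dots>\<close> by repeatedly removing a vertex of minimum degree, so that each \<open>h\<^sub>i\<close> has at most
  \<open>\<delta>(H)\<close> later neighbours, and determine the classes in this order.  As long as some unassigned vertex
  \<open>v\<close> is adjacent to a vertex of class \<open>h\<^sub>i\<close>, its own class is \<open>h\<^sub>i\<close> or a later neighbour of \<open>h\<^sub>i\<close>; an earlier
  class is impossible, because a connected class all of whose current neighbours are assigned is
  complete.  So there are at most \<open>\<delta>(H) + 1\<close> choices for each of the \<open>k\<close> vertices outside \<open>H\<close>.  The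
  program runs through all \<open>k\<close>-digit numbers in base \<open>d + 1\<close>, where \<open>d \<le> \<delta>(H)\<close> is the width of the
  order, and verifies each resulting partition in polynomial time.
\<close>

section \<open>Loop programs\<close>

text \<open>The machine has no procedures, so a branching search would need an explicit stack;
  running through all numbers flattens the search tree into one counted loop. Its limit
  \<open>N\<close> is the only one that is not polynomial in the number of vertices, so the running
  time is a static polynomial times \<open>N\<close>. The two directions of correctness stay
  separate. Soundness rests on the final verification alone and holds for every number, even one
  whose digits select meaningless colours. Completeness concerns a single number for each given
  \<open>\<phi>\<close>, and only this run is followed by an invariant; nothing is claimed about the
  other runs. The degeneracy itself is never computed. The bound on the width \<open>d\<close> holds
  because each removed vertex has minimum degree in the subgraph induced by the remaining vertices,
  and the degeneracy bounds every such minimum. Multiplication and division are replaced by repeated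
  addition and subtraction, with at most \<open>d + 1\<close> rounds each. Labels may be arbitrarily
  large, so arrays indexed by labels cannot be cleared as a whole; it is carried along that the
  colours outside \<open>G\<close> stay 0.\<close>

text \<open>
  A fragment of the machine language in which every loop counts up to a bound that stays fixed.
  Its programs denote total functions on memories, and their running time is bounded by a static
  expression in bounds on the loop limits.
\<close>

datatype loop =
    Asg string aexp aexp
  | Sq loop loop (infixr \<open>;;\<close> 60)
  | Cond bexp loop
  | For string string loop

abbreviation Var :: "string \<Rightarrow> aexp" where
  "Var x \<equiv> Read x (Const 0)"

abbreviation Set :: "string \<Rightarrow> aexp \<Rightarrow> loop" where
  "Set x \<equiv> Asg x (Const 0)"

primrec compile :: "loop \<Rightarrow> com" where
  "compile (Asg x a b) = Write x a b"
| "compile (p ;; q) = Seq (compile p) (compile q)"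
| "compile (Cond b p) = Ite b (compile p) Skip"
| "compile (For x y p) = Seq (Write x (Const 0) (Const 0))
     (While (Less (Var x) (Var y)) (Seq (compile p) (Write x (Const 0) (Plus (Var x) (Const 1)))))"

definition put :: "string \<Rightarrow> nat \<Rightarrow> memory \<Rightarrow> memory" where
  "put x v s = s(x := (s x)(0 := v))"

lemma put_simps [simp]:
  "put x v s x 0 = v" "z \<noteq> x \<Longrightarrow> put x v s z = s z"
  by (auto simp: put_def)

text \<open>\<open>iter f x i s\<close> is the memory at the loop test that sees counter value
  \<open>i\<close>: as in the compiled loop, the counter is written last in each round.\<close>

primrec iter :: "(memory \<Rightarrow> memory) \<Rightarrow> string \<Rightarrow> nat \<Rightarrow> memory \<Rightarrow> memory" where
  "iter f x 0 s = put x 0 s"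
| "iter f x (Suc i) s = put x (Suc i) (f (iter f x i s))"

text \<open>The limit of a loop is read once, from the initial memory, while the compiled loop
  rereads it at every test. The two agree if no limit is ever written, which
  \<open>exec_compile\<close> demands.\<close>

primrec den :: "loop \<Rightarrow> memory \<Rightarrow> memory" where
  "den (Asg x a b) s = s(x := (s x)(aval a s := aval b s))"
| "den (p ;; q) s = den q (den p s)"
| "den (Cond b p) s = (if bval b s then den p s else s)"
| "den (For x y p) s = iter (den p) x (s y 0) s"

primrec wr :: "loop \<Rightarrow> string set" where
  "wr (Asg x a b) = {x}"
| "wr (p ;; q) = wr p \<union> wr q"
| "wr (Cond b p) = wr p"
| "wr (For x y p) = insert x (wr p)"

primrec bds :: "loop \<Rightarrow> string set" where
  "bds (Asg x a b) = {}"
| "bds (p ;; q) = bds p \<union> bds q"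
| "bds (Cond b p) = bds p"
| "bds (For x y p) = insert y (bds p)"

primrec wf_loop :: "loop \<Rightarrow> bool" where
  "wf_loop (Asg x a b) = True"
| "wf_loop (p ;; q) = (wf_loop p \<and> wf_loop q)"
| "wf_loop (Cond b p) = wf_loop p"
| "wf_loop (For x y p) = (x \<notin> wr p \<and> wf_loop p)"

text \<open>In a loop, 9 is 3 for setting the counter plus 6 for the failing test, and 12 is 6 for a
  successful test plus 6 for the increment. The 2 of \<open>Cond\<close> covers the branch itself
  and a possible \<open>Skip\<close>.\<close>

primrec tb :: "loop \<Rightarrow> (string \<Rightarrow> nat) \<Rightarrow> nat" where
  "tb (Asg x a b) L = 1 + acost a + acost b"
| "tb (p ;; q) L = tb p L + tb q L"
| "tb (Cond b p) L = 2 + bcost b + tb p L"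
| "tb (For x y p) L = 9 + L y * (12 + tb p L)"

lemma den_frame: "z \<notin> wr p \<Longrightarrow> den p s z = s z"
proof (induction p arbitrary: s)
  case (For x y p)
  have "iter (den p) x i s z = s z" for i
    using For by (induction i) auto
  then show ?case by simp
qed auto

lemma iter_frame: "z \<notin> insert x (wr p) \<Longrightarrow> iter (den p) x i s z = s z"
  by (induction i) (auto simp: den_frame)

lemma iter_counter: "iter f x i s x 0 = i"
  by (cases i) auto

text \<open>Each round also receives the frame condition and the counter value, so an invariant only
  has to speak about what the loop changes.\<close>

lemma for_inv:
  assumes "I 0 (put x 0 s)"
    and "\<And>i t. i < s y 0 \<Longrightarrow> t x 0 = i \<Longrightarrow> (\<And>z. z \<notin> wr (For x y p) \<Longrightarrow> t z = s z) \<Longrightarrow> I i t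
           \<Longrightarrow> I (Suc i) (put x (Suc i) (den p t))"
  shows "I (s y 0) (den (For x y p) s)"
proof -
  have "i \<le> s y 0 \<Longrightarrow> I i (iter (den p) x i s)" for i
  proof (induction i)
    case (Suc i)
    then show ?case
      using assms(2)[of i "iter (den p) x i s"] by (auto simp: iter_counter iter_frame)
  qed (use assms(1) in simp)
  then show ?thesis by simp
qed

theorem exec_compile:
  assumes "wf_loop p" "bds p \<inter> wr p = {}" "\<And>y. y \<in> bds p \<Longrightarrow> s y 0 \<le> L y"
  shows "\<exists>t. t \<le> tb p L \<and> exec (compile p) s t (den p s)"
  using assms
proof (induction p arbitrary: s)
  case (Asg x a b)
  show ?case unfolding compile.simps den.simps tb.simps using exec.Write order.refl by blast
next
  case (Sq p q)
  have "\<exists>t. t \<le> tb p L \<and> exec (compile p) s t (den p s)"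
    using Sq.prems by (intro Sq.IH) auto
  then obtain t where t: "t \<le> tb p L" "exec (compile p) s t (den p s)" by blast
  have "\<exists>t. t \<le> tb q L \<and> exec (compile q) (den p s) t (den q (den p s))"
  proof (rule Sq.IH(2))
    fix y assume "y \<in> bds q"
    then have "y \<notin> wr p" "s y 0 \<le> L y" using Sq.prems by auto
    then show "den p s y 0 \<le> L y" by (simp add: den_frame)
  qed (use Sq.prems in auto)
  then obtain u where u: "u \<le> tb q L" "exec (compile q) (den p s) u (den q (den p s))" by blast
  show ?case using exec.Seq[OF t(2) u(2)] t(1) u(1) by (auto intro!: exI[of _ "t + u"])
next
  case (Cond b p)
  show ?case
  proof (cases "bval b s")
    case True
    have "\<exists>t. t \<le> tb p L \<and> exec (compile p) s t (den p s)"
      using Cond.prems by (intro Cond.IH) auto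
    then obtain t where "t \<le> tb p L" "exec (compile p) s t (den p s)" by blast
    then show ?thesis using exec.IfTrue[of b s "compile p" t "den p s" Skip] True
      by (auto intro!: exI[of _ "1 + bcost b + t"])
  next
    case False
    then show ?thesis using exec.IfFalse[OF False exec.Skip, of "compile p"]
      by (auto intro!: exI[of _ "1 + bcost b + 1"])
  qed
next
  case (For x y p)
  let ?c = "Seq (compile p) (Write x (Const 0) (Plus (Var x) (Const 1)))"
  let ?b = "Less (Var x) (Var y)"
  define N where "N = s y 0"
  have xy: "x \<noteq> y" "y \<notin> wr p" "x \<notin> wr p" using For.prems by auto
  have y: "iter (den p) x i s y 0 = N" for i
    using xy iter_frame[of y x p i s] by (simp add: N_def)
  have body: "\<exists>t. t \<le> tb p L + 6 \<and> exec ?c (iter (den p) x i s) t (iter (den p) x (Suc i) s)" for i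
  proof -
    let ?s = "iter (den p) x i s"
    have "\<exists>t. t \<le> tb p L \<and> exec (compile p) ?s t (den p ?s)"
    proof (rule For.IH)
      fix z assume z: "z \<in> bds p"
      then have "z \<notin> insert x (wr p)" "s z 0 \<le> L z" using For.prems by auto
      then show "?s z 0 \<le> L z" by (simp add: iter_frame)
    qed (use For.prems in auto)
    then obtain t where t: "t \<le> tb p L" "exec (compile p) ?s t (den p ?s)" by blast
    have x: "den p ?s x 0 = i" using xy by (simp add: den_frame iter_counter)
    have "exec (Write x (Const 0) (Plus (Var x) (Const 1))) (den p ?s) 6 (iter (den p) x (Suc i) s)"
      using exec.Write[of x "Const 0" "Plus (Var x) (Const 1)" "den p ?s"] x by (simp add: put_def numeral_eq_Suc)
    from exec.Seq[OF t(2) this] t(1) show ?thesis by (auto intro!: exI[of _ "t + 6"])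
  qed
  \<comment> \<open>Executions of \<open>While\<close> unfold at the front, so the induction is on
    the number \<open>j\<close> of rounds still to come.\<close>
  have "j \<le> N \<Longrightarrow> \<exists>t. t \<le> 6 + j * (12 + tb p L) \<and>
     exec (While ?b ?c) (iter (den p) x (N - j) s) t (iter (den p) x N s)" for j
  proof (induction j)
    case 0
    have "\<not> bval ?b (iter (den p) x N s)" by (simp add: iter_counter y)
    from exec.WhileFalse[OF this, of ?c] show ?case by (auto simp: numeral_eq_Suc)
  next
    case (Suc j)
    obtain t where t: "t \<le> 6 + j * (12 + tb p L)"
      "exec (While ?b ?c) (iter (den p) x (N - j) s) t (iter (den p) x N s)"
      using Suc by auto
    obtain u where u: "u \<le> tb p L + 6"
      "exec ?c (iter (den p) x (N - Suc j) s) u (iter (den p) x (Suc (N - Suc j)) s)"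
      using body by blast
    have "bval ?b (iter (den p) x (N - Suc j) s)" using Suc.prems by (simp add: iter_counter y)
    moreover have "Suc (N - Suc j) = N - j" using Suc.prems by simp
    ultimately have "exec (While ?b ?c) (iter (den p) x (N - Suc j) s) (1 + bcost ?b + u + t)
        (iter (den p) x N s)"
      using exec.WhileTrue u(2) t(2) by metis
    then show ?case using t(1) u(1) by (intro exI[of _ "1 + bcost ?b + u + t"]) simp
  qed
  from this[of N] obtain t where t: "t \<le> 6 + N * (12 + tb p L)"
    "exec (While ?b ?c) (iter (den p) x 0 s) t (iter (den p) x N s)" by auto
  have "exec (Write x (Const 0) (Const 0)) s 3 (iter (den p) x 0 s)"
    using exec.Write[of x "Const 0" "Const 0" s] by (simp add: put_def numeral_eq_Suc)
  from exec.Seq[OF this t(2)] have "exec (compile (For x y p)) s (3 + t) (den (For x y p) s)"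
    by (simp add: N_def)
  moreover have "N * (12 + tb p L) \<le> L y * (12 + tb p L)"
    using For.prems(3)[of y] unfolding N_def by (intro mult_right_mono) auto
  then have "3 + t \<le> tb (For x y p) L" using t(1) unfolding tb.simps by linarith
  ultimately show ?case by blast
qed

section \<open>Contractions as partitions into connected classes\<close>

definition same_class :: "'a graph \<Rightarrow> ('a \<Rightarrow> 'b) \<Rightarrow> 'a \<Rightarrow> 'a \<Rightarrow> bool" where
  "same_class G \<phi> a b \<longleftrightarrow> {a, b} \<in> edges G \<and> \<phi> a = \<phi> b"

text \<open>\<open>\<phi>\<close> sends a vertex to the label that survives in its class, hence it
  fixes \<open>verts H\<close>. Connectivity of a class is measured from that label, and
  \<open>x \<noteq> y\<close> keeps edges inside a class out of the quotient.\<close>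

definition contraction_map :: "'a graph \<Rightarrow> 'a graph \<Rightarrow> ('a \<Rightarrow> 'a) \<Rightarrow> bool" where
  "contraction_map G H \<phi> \<longleftrightarrow> verts H \<subseteq> verts G \<and> \<phi> ` verts G \<subseteq> verts H \<and>
     (\<forall>h \<in> verts H. \<phi> h = h) \<and> (\<forall>v \<in> verts G. (same_class G \<phi>)\<^sup>*\<^sup>* (\<phi> v) v) \<and>
     (\<forall>x y. x \<noteq> y \<longrightarrow> ({x, y} \<in> edges H \<longleftrightarrow> (\<exists>a b. {a, b} \<in> edges G \<and> \<phi> a = x \<and> \<phi> b = y)))"

lemma simple_graph_edgeD:
  assumes "simple_graph G" "{a, b} \<in> edges G"
  shows "a \<in> verts G" "b \<in> verts G" "a \<noteq> b"
  using assms by (auto simp: simple_graph_def dest!: bspec[of _ _ "{a, b}"])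

lemma simple_graph_edgeE:
  assumes "simple_graph G" "e \<in> edges G"
  obtains a b where "e = {a, b}" "a \<noteq> b"
  using assms by (auto simp: simple_graph_def card_2_iff)

lemma verts_contract [simp]: "verts (contract G u v) = verts G - {v}"
  by (simp add: contract_def delete_vertex_def add_edges_def)

text \<open>A neighbour of \<open>v\<close> for which \<open>contract\<close> adds no edge, because
  it is already adjacent to \<open>u\<close>, is covered by the first disjunct.\<close>

lemma contract_edges_iff:
  assumes "simple_graph G" "{u, v} \<in> edges G"
  shows "{a, b} \<in> edges (contract G u v) \<longleftrightarrow> a \<noteq> b \<and> a \<noteq> v \<and> b \<noteq> v \<and>
    ({a, b} \<in> edges G \<or> a = u \<and> {v, b} \<in> edges G \<or> b = u \<and> {v, a} \<in> edges G)"
  using simple_graph_edgeD[OF assms(1)] assms(2)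
  by (auto simp: contract_def delete_vertex_def add_edges_def nbrs_def doubleton_eq_iff insert_commute)

lemma simple_graph_contract:
  assumes "simple_graph G" "{u, v} \<in> edges G"
  shows "simple_graph (contract G u v)"
  unfolding simple_graph_def
proof (intro conjI ballI)
  show "finite (verts (contract G u v))" using assms(1) by (simp add: simple_graph_def)
  fix e assume e: "e \<in> edges (contract G u v)"
  then have "v \<notin> e" by (simp add: contract_def delete_vertex_def add_edges_def)
  from e consider "e \<in> edges G" | w where "e = {u, w}" "{v, w} \<in> edges G" "w \<noteq> u"
    by (auto simp: contract_def delete_vertex_def add_edges_def nbrs_def)
  then have "e \<subseteq> verts G \<and> card e = 2"
  proof cases
    case 1
    then show ?thesis using assms(1) by (simp add: simple_graph_def)
  next
    case 2
    then show ?thesis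
      using simple_graph_edgeD(1)[OF assms] simple_graph_edgeD(2)[OF assms(1), of v w] by auto
  qed
  then show "e \<subseteq> verts (contract G u v)" "card e = 2" using \<open>v \<notin> e\<close> by auto
qed

text \<open>The deleted vertex \<open>v\<close> joins the class of \<open>u\<close>. An edge at
  \<open>u\<close> that was created by the contraction is traced back to an edge at
  \<open>v\<close>, so a step inside a class becomes at most two steps, the detour running through
  \<open>v\<close>.\<close>

lemma contraction_map_uncontract:
  assumes G: "simple_graph G" and uv: "{u, v} \<in> edges G"
    and \<phi>: "contraction_map (contract G u v) H \<phi>"
  shows "contraction_map G H (\<phi>(v := \<phi> u))"
proof -
  let ?\<psi> = "\<phi>(v := \<phi> u)" and ?K = "contract G u v"
  note K = contract_edges_iff[OF G uv]
  note E = simple_graph_edgeD[OF G]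
  have ne: "u \<noteq> v" "u \<in> verts G" "v \<in> verts G" using E[OF uv] by auto
  have vu: "{v, u} \<in> edges G" using uv by (simp add: insert_commute)
  have H: "verts H \<subseteq> verts G - {v}" "\<phi> ` (verts G - {v}) \<subseteq> verts H"
    "\<And>h. h \<in> verts H \<Longrightarrow> \<phi> h = h"
    using \<phi> by (auto simp: contraction_map_def)
  have conn: "(same_class ?K \<phi>)\<^sup>*\<^sup>* (\<phi> w) w" if "w \<in> verts G - {v}" for w
    using \<phi> that by (auto simp: contraction_map_def)
  have quot: "\<And>x y. x \<noteq> y \<Longrightarrow>
      {x, y} \<in> edges H \<longleftrightarrow> (\<exists>a b. {a, b} \<in> edges ?K \<and> \<phi> a = x \<and> \<phi> b = y)"
    using \<phi> by (auto simp: contraction_map_def)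
  have edge: "(same_class G ?\<psi>)\<^sup>*\<^sup>* a b" if st: "same_class ?K \<phi> a b" for a b
  proof -
    have ab: "a \<noteq> v" "b \<noteq> v" "\<phi> a = \<phi> b" using st by (auto simp: same_class_def K)
    consider "{a, b} \<in> edges G" | "a = u" "{v, b} \<in> edges G" | "b = u" "{v, a} \<in> edges G"
      using st by (auto simp: same_class_def K)
    then show ?thesis
    proof cases
      case 1 then show ?thesis using ab by (intro r_into_rtranclp) (auto simp: same_class_def)
    next
      case 2
      then have "same_class G ?\<psi> a v" "same_class G ?\<psi> v b"
        using ab ne uv by (auto simp: same_class_def)
      then show ?thesis by auto
    next
      case 3
      then have "same_class G ?\<psi> a v" "same_class G ?\<psi> v b"
        using ab ne vu by (auto simp: same_class_def insert_commute)
      then show ?thesis by auto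
    qed
  qed
  have lift: "(same_class G ?\<psi>)\<^sup>*\<^sup>* a b" if "(same_class ?K \<phi>)\<^sup>*\<^sup>* a b" for a b
    using that
  proof (induction rule: rtranclp_induct)
    case (step y z)
    then show ?case using edge[of y z] by (meson rtranclp_trans)
  qed simp
  have c1: "(same_class G ?\<psi>)\<^sup>*\<^sup>* (?\<psi> w) w" if "w \<in> verts G" for w
  proof (cases "w = v")
    case True
    have "(same_class G ?\<psi>)\<^sup>*\<^sup>* (\<phi> u) u" using lift conn ne by simp
    moreover have "same_class G ?\<psi> u v" using uv ne by (auto simp: same_class_def)
    ultimately show ?thesis using True by (simp add: rtranclp.rtrancl_into_rtrancl)
  qed (use that lift conn in auto)
  have c2: "{x, y} \<in> edges H \<longleftrightarrow> (\<exists>a b. {a, b} \<in> edges G \<and> ?\<psi> a = x \<and> ?\<psi> b = y)"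
    if xy: "x \<noteq> y" for x y
  proof
    assume "{x, y} \<in> edges H"
    then obtain a b where ab: "{a, b} \<in> edges ?K" "\<phi> a = x" "\<phi> b = y" using quot[OF xy] by blast
    from ab(1) have n: "a \<noteq> v" "b \<noteq> v" by (auto simp: K)
    consider "{a, b} \<in> edges G" | "a = u" "{v, b} \<in> edges G" | "b = u" "{a, v} \<in> edges G"
      using ab(1) by (auto simp: K insert_commute)
    then show "\<exists>a b. {a, b} \<in> edges G \<and> ?\<psi> a = x \<and> ?\<psi> b = y"
    proof cases
      case 1 then show ?thesis using ab n by (intro exI[of _ a] exI[of _ b]) auto
    next
      case 2 then show ?thesis using ab n by (intro exI[of _ v] exI[of _ b]) auto
    next
      case 3 then show ?thesis using ab n by (intro exI[of _ a] exI[of _ v]) auto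
    qed
  next
    assume "\<exists>a b. {a, b} \<in> edges G \<and> ?\<psi> a = x \<and> ?\<psi> b = y"
    then obtain a b where ab: "{a, b} \<in> edges G" "?\<psi> a = x" "?\<psi> b = y" by blast
    \<comment> \<open>Redirecting \<open>v\<close> to \<open>u\<close> preserves classes; since
      \<open>x \<noteq> y\<close>, the redirected edge is no loop and is present in
      \<open>?K\<close>.\<close>
    let ?r = "\<lambda>a. if a = v then u else a"
    have "a \<noteq> b" using E ab(1) by blast
    have "\<phi> (?r a) = x" "\<phi> (?r b) = y" using ab by auto
    moreover from this have "{?r a, ?r b} \<in> edges ?K"
      using ab(1) that \<open>a \<noteq> b\<close> ne by (auto simp: K insert_commute)
    ultimately show "{x, y} \<in> edges H" using quot[OF xy] by blast
  qed
  show ?thesis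
    unfolding contraction_map_def using H ne c1 c2 by auto
qed

text \<open>Redirecting \<open>v\<close> to \<open>u\<close> maps paths inside a class of
  \<open>G\<close> to paths of the contracted graph, where a step between \<open>u\<close> and
  \<open>v\<close> collapses. As \<open>v\<close> is not a label of \<open>H\<close>, no
  representative is lost.\<close>

lemma contraction_map_contract:
  assumes G: "simple_graph G" and uv: "{u, v} \<in> edges G" "\<phi> u = \<phi> v" "v \<notin> verts H"
    and \<phi>: "contraction_map G H \<phi>"
  shows "contraction_map (contract G u v) H \<phi>"
proof -
  let ?K = "contract G u v"
  note K = contract_edges_iff[OF G uv(1)]
  note E = simple_graph_edgeD[OF G]
  have ne: "u \<noteq> v" "u \<in> verts G" "v \<in> verts G" using E[OF uv(1)] by auto
  let ?r = "\<lambda>a. if a = v then u else a"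
  have H: "verts H \<subseteq> verts G" "\<phi> ` verts G \<subseteq> verts H" "\<And>h. h \<in> verts H \<Longrightarrow> \<phi> h = h"
    using \<phi> by (auto simp: contraction_map_def)
  have conn: "(same_class G \<phi>)\<^sup>*\<^sup>* (\<phi> w) w" if "w \<in> verts G" for w
    using \<phi> that by (auto simp: contraction_map_def)
  have quot: "\<And>x y. x \<noteq> y \<Longrightarrow>
      {x, y} \<in> edges H \<longleftrightarrow> (\<exists>a b. {a, b} \<in> edges G \<and> \<phi> a = x \<and> \<phi> b = y)"
    using \<phi> by (auto simp: contraction_map_def)
  have edge: "(same_class ?K \<phi>)\<^sup>*\<^sup>* (?r a) (?r b)" if "same_class G \<phi> a b" for a b
  proof (cases "?r a = ?r b")
    case False
    then have "same_class ?K \<phi> (?r a) (?r b)"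
      using that uv ne E by (auto simp: same_class_def K insert_commute)
    then show ?thesis by blast
  qed simp
  have lift: "(same_class ?K \<phi>)\<^sup>*\<^sup>* (?r a) (?r b)" if "(same_class G \<phi>)\<^sup>*\<^sup>* a b" for a b
    using that
  proof (induction rule: rtranclp_induct)
    case (step y z)
    then show ?case using edge[of y z] by (meson rtranclp_trans)
  qed simp
  have c1: "(same_class ?K \<phi>)\<^sup>*\<^sup>* (\<phi> w) w" if "w \<in> verts G - {v}" for w
  proof -
    \<comment> \<open>The path starts at a label of \<open>H\<close>, which the redirection leaves
      in place.\<close>
    have "\<phi> w \<noteq> v" using that H uv by auto
    then show ?thesis using lift[OF conn, of w] that by simp
  qed
  have c2: "{x, y} \<in> edges H \<longleftrightarrow> (\<exists>a b. {a, b} \<in> edges ?K \<and> \<phi> a = x \<and> \<phi> b = y)"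
    if xy: "x \<noteq> y" for x y
  proof
    assume "{x, y} \<in> edges H"
    then obtain a b where ab: "{a, b} \<in> edges G" "\<phi> a = x" "\<phi> b = y" using quot[OF xy] by blast
    have "a \<noteq> b" using E ab(1) by blast
    have "\<phi> (?r a) = x" "\<phi> (?r b) = y" using ab uv by auto
    moreover from this have "{?r a, ?r b} \<in> edges ?K"
      using ab(1) that \<open>a \<noteq> b\<close> ne by (auto simp: K insert_commute)
    ultimately show "\<exists>a b. {a, b} \<in> edges ?K \<and> \<phi> a = x \<and> \<phi> b = y" by blast
  next
    assume "\<exists>a b. {a, b} \<in> edges ?K \<and> \<phi> a = x \<and> \<phi> b = y"
    then obtain a b where ab: "{a, b} \<in> edges ?K" "\<phi> a = x" "\<phi> b = y" by blast
    consider "{a, b} \<in> edges G" | "a = u" "{v, b} \<in> edges G" | "b = u" "{a, v} \<in> edges G"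
      using ab(1) by (auto simp: K insert_commute)
    then have "\<exists>a b. {a, b} \<in> edges G \<and> \<phi> a = x \<and> \<phi> b = y"
      using ab uv(2) by cases metis+
    then show "{x, y} \<in> edges H" using quot[OF xy] by blast
  qed
  show ?thesis
    unfolding contraction_map_def using H uv(3) c1 c2 by auto
qed

lemma contraction_map_refl:
  "contraction_map H H (\<lambda>v. v)"
  unfolding contraction_map_def by auto

text \<open>By induction on the number of vertices: a non-trivial class has an edge at its own
  label, and contracting this edge into the label preserves the map. If no vertex is left outside
  \<open>H\<close>, then \<open>\<phi>\<close> is the identity and the quotient is the graph
  itself.\<close>

lemma contraction_map_imp_contraction:
  assumes "simple_graph G" "simple_graph H" "contraction_map G H \<phi>"
  shows "labeled_contraction_of H G"
  using assms
proof (induction "card (verts G)" arbitrary: G rule: less_induct)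
  case less
  note \<phi> = less.prems(3)
  note E = simple_graph_edgeD[OF less.prems(1)]
  show ?case
  proof (cases "verts G = verts H")
    case True
    then have id: "\<phi> v = v" if "v \<in> verts G" for v using \<phi> that by (auto simp: contraction_map_def)
    have "{x, y} \<in> edges H \<longleftrightarrow> {x, y} \<in> edges G" if xy: "x \<noteq> y" for x y
    proof -
      have "{x, y} \<in> edges H \<longleftrightarrow> (\<exists>a b. {a, b} \<in> edges G \<and> \<phi> a = x \<and> \<phi> b = y)"
        using \<phi> that by (auto simp: contraction_map_def)
      also have "\<dots> \<longleftrightarrow> {x, y} \<in> edges G" using id E by metis
      finally show ?thesis .
    qed
    then have "edges G = edges H"
      using simple_graph_edgeE[OF less.prems(1)] simple_graph_edgeE[OF less.prems(2)]
      by (metis subsetI subset_antisym)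
    then have "G = H" using True by (simp add: graph.expand)
    then show ?thesis by (simp add: labeled_contraction_of_def)
  next
    case False
    then obtain v where v: "v \<in> verts G" "v \<notin> verts H" using \<phi> by (auto simp: contraction_map_def)
    define h where "h = \<phi> v"
    have h: "h \<in> verts H" "h \<noteq> v" "\<phi> h = h" using v \<phi> by (auto simp: contraction_map_def h_def)
    have "(same_class G \<phi>)\<^sup>*\<^sup>* h v" using v \<phi> by (auto simp: contraction_map_def h_def)
    \<comment> \<open>\<open>v\<close> may be far from its label \<open>h\<close>; the edge to
      contract is the first one on a path from \<open>h\<close> to \<open>v\<close>.\<close>
    then obtain w where w: "same_class G \<phi> h w" using h by (metis converse_rtranclpE)
    then have hw: "{h, w} \<in> edges G" "\<phi> h = \<phi> w" by (auto simp: same_class_def)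
    \<comment> \<open>A label is fixed by \<open>\<phi>\<close>, so \<open>w\<close> would equal
      \<open>h\<close>, although \<open>{h, w}\<close> is an edge.\<close>
    have "w \<notin> verts H" using hw h E \<phi> by (metis contraction_map_def)
    then have "contraction_map (contract G h w) H \<phi>"
      using contraction_map_contract[OF less.prems(1) hw _ \<phi>] by blast
    moreover have "card (verts (contract G h w)) < card (verts G)"
      using E[OF hw(1)] less.prems(1) by (intro psubset_card_mono) (auto simp: simple_graph_def)
    ultimately have "labeled_contraction_of H (contract G h w)"
      using less.hyps simple_graph_contract[OF less.prems(1) hw(1)] less.prems(2) by blast
    moreover have "contraction_step G (contract G h w)"
      using hw by (auto simp: contraction_step_def)
    ultimately show ?thesis by (simp add: labeled_contraction_of_def converse_rtranclp_into_rtranclp)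
  qed
qed

text \<open>Starting from the identity on \<open>H\<close>, the contractions are undone one by one,
  from the last to the first.\<close>

lemma contraction_imp_contraction_map:
  assumes "labeled_contraction_of H G" "simple_graph G"
  shows "\<exists>\<phi>. contraction_map G H \<phi>"
proof -
  have "contraction_step\<^sup>*\<^sup>* G H" using assms(1) by (simp add: labeled_contraction_of_def)
  then show ?thesis using assms(2)
  proof (induction rule: converse_rtranclp_induct)
    case base
    then show ?case using contraction_map_refl by blast
  next
    case (step G G')
    then obtain u v where "{u, v} \<in> edges G" "G' = contract G u v" by (auto simp: contraction_step_def)
    then show ?case using step contraction_map_uncontract simple_graph_contract by metis
  qed
qed

theorem labeled_contraction_iff:
  assumes "simple_graph G" "simple_graph H"
  shows "labeled_contraction_of H G \<longleftrightarrow> (\<exists>\<phi>. contraction_map G H \<phi>)"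
  using assms contraction_map_imp_contraction contraction_imp_contraction_map by blast

section \<open>Reconstructing a partition from few guesses\<close>

text \<open>
  One step of a graph search along a directed edge \<open>(a, b)\<close>, where the value 0 marks the unvisited
  vertices.  Both the colouring phases and the connectivity test are iterated sweeps of such steps.
\<close>

definition spread :: "(nat \<Rightarrow> 'a \<Rightarrow> 'a \<Rightarrow> bool) \<Rightarrow> ('a \<Rightarrow> nat) \<Rightarrow> 'a \<times> 'a \<Rightarrow> ('a \<Rightarrow> nat) \<Rightarrow> 'a \<Rightarrow> nat" where
  "spread P g = (\<lambda>(a, b) r. if P (r a) a b \<and> r b = 0 then r(b := g b) else r)"

definition extends :: "('a \<Rightarrow> nat) \<Rightarrow> ('a \<Rightarrow> nat) \<Rightarrow> bool" where
  "extends r r' \<longleftrightarrow> (\<forall>v. r v \<noteq> 0 \<longrightarrow> r' v = r v)"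

text \<open>The only change ever made is giving a value to one unvisited vertex. Invariants are
  checked for this event alone, so the order of the edges in \<open>E\<close> never matters.\<close>

lemma fold_spread_induct:
  assumes "Q r"
    and "\<And>r a b. Q r \<Longrightarrow> (a, b) \<in> set E \<Longrightarrow> P (r a) a b \<Longrightarrow> r b = 0 \<Longrightarrow> Q (r(b := g b))"
  shows "Q (fold (spread P g) E r)"
  using assms
proof (induction E arbitrary: r)
  case (Cons e E)
  have "Q (spread P g e r)" using Cons.prems(1) by (cases e) (auto simp: spread_def intro!: Cons.prems(2))
  then have "Q (fold (spread P g) E (spread P g e r))" using Cons.prems(2) by (intro Cons.IH) auto
  then show ?case by simp
qed simp

lemma funpow_spread_induct:
  assumes "Q r"
    and "\<And>r a b. Q r \<Longrightarrow> (a, b) \<in> set E \<Longrightarrow> P (r a) a b \<Longrightarrow> r b = 0 \<Longrightarrow> Q (r(b := g b))"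
  shows "Q ((fold (spread P g) E ^^ n) r)"
proof (induction n)
  case (Suc n)
  then show ?case by (simp add: fold_spread_induct[where Q = Q] assms(2))
qed (use assms in simp)

lemma extends_fold_spread: "extends r (fold (spread P g) E r)"
  by (rule fold_spread_induct) (auto simp: extends_def)

lemma extends_funpow_spread: "extends r ((fold (spread P g) E ^^ n) r)"
  by (rule funpow_spread_induct) (auto simp: extends_def)

text \<open>A sweep tests its edges in intermediate states. Values never change once set, so if the
  whole sweep changes nothing, the state just before \<open>(a, b)\<close> is already
  \<open>r\<close>, and the step there would have set \<open>b\<close>.\<close>

lemma fold_spread_fixed:
  assumes "\<And>b. g b \<noteq> 0" "fold (spread P g) E r = r" "(a, b) \<in> set E" "P (r a) a b"
  shows "r b \<noteq> 0"
proof
  assume b: "r b = 0"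
  obtain E1 E2 where E: "E = E1 @ (a, b) # E2" using assms(3) by (meson split_list)
  define r1 where "r1 = fold (spread P g) E1 r"
  have 1: "extends r r1" unfolding r1_def by (rule extends_fold_spread)
  have r: "r = fold (spread P g) E2 (spread P g (a, b) r1)" using assms(2) by (simp add: E r1_def)
  then have 2: "extends (spread P g (a, b) r1) r" by (metis extends_fold_spread)
  have 3: "extends r1 r"
    unfolding extends_def
  proof (intro allI impI)
    fix v assume "r1 v \<noteq> 0"
    then have "spread P g (a, b) r1 v = r1 v" by (auto simp: spread_def)
    then show "r v = r1 v" using 2 \<open>r1 v \<noteq> 0\<close> unfolding extends_def by metis
  qed
  have "r1 = r" using 1 3 unfolding extends_def by (metis ext)
  then show False using 2 b assms(1)[of b] assms(4)
    by (auto simp: extends_def spread_def dest!: spec[of _ b])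
qed

text \<open>If the \<open>n\<close>-th iterate were not fixed, no earlier one would be, and
  \<open>\<mu>\<close> would have grown \<open>n + 1\<close> times, beyond its bound
  \<open>n\<close>.\<close>

lemma funpow_fixed:
  fixes \<mu> :: "'b \<Rightarrow> nat"
  assumes "\<And>x. F x \<noteq> x \<Longrightarrow> \<mu> x < \<mu> (F x)" "\<And>x. \<mu> x \<le> n"
  shows "F ((F ^^ n) x) = (F ^^ n) x"
proof (rule ccontr)
  assume neq: "F ((F ^^ n) x) \<noteq> (F ^^ n) x"
  have "F ((F ^^ r) x) \<noteq> (F ^^ r) x" if "r \<le> n" for r
  proof
    assume "F ((F ^^ r) x) = (F ^^ r) x"
    then have "(F ^^ i) ((F ^^ r) x) = (F ^^ r) x" for i by (induction i) auto
    from this[of "n - r"] this[of "Suc (n - r)"] that neq show False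
      by (metis funpow_add le_add_diff_inverse2 o_apply funpow.simps(2))
  qed
  then have "r \<le> \<mu> ((F ^^ r) x)" if "r \<le> Suc n" for r
    using that
  proof (induction r)
    case (Suc r)
    then have "r \<le> \<mu> ((F ^^ r) x)" "\<mu> ((F ^^ r) x) < \<mu> (F ((F ^^ r) x))"
      by (auto intro!: assms(1))
    then show ?case by simp
  qed simp
  from this[of "Suc n"] assms(2)[of "(F ^^ Suc n) x"] show False by simp
qed

text \<open>The potential is the number of visited vertices of \<open>V\<close>. This is why as many
  sweeps as there are vertices complete the search.\<close>

lemma funpow_spread_closed:
  assumes g: "\<And>b. g b \<noteq> 0" and "finite V" "card V \<le> n" "\<And>a b. (a, b) \<in> set E \<Longrightarrow> b \<in> V"
  shows "\<forall>(a, b) \<in> set E. P ((fold (spread P g) E ^^ n) r a) a b \<longrightarrow> (fold (spread P g) E ^^ n) r b \<noteq> 0"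
proof -
  let ?F = "fold (spread P g) E" and ?\<mu> = "\<lambda>r. card {v \<in> V. r v \<noteq> (0::nat)}"
  have "?F ((?F ^^ n) r) = (?F ^^ n) r"
  proof (rule funpow_fixed[where \<mu> = ?\<mu>])
    fix x assume neq: "?F x \<noteq> x"
    have ext: "extends x (?F x)" by (rule extends_fold_spread)
    have out: "\<forall>v. v \<notin> V \<longrightarrow> ?F x v = x v"
      by (rule fold_spread_induct[where Q = "\<lambda>r. \<forall>v. v \<notin> V \<longrightarrow> r v = x v"]) (use assms in auto)
    from neq obtain v where "?F x v \<noteq> x v" by auto
    then have v: "x v = 0" "?F x v \<noteq> 0" "v \<in> V" using ext out unfolding extends_def by metis+
    show "?\<mu> x < ?\<mu> (?F x)"
    proof (rule psubset_card_mono)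
      show "finite {v \<in> V. ?F x v \<noteq> 0}" using assms by simp
      have "{v \<in> V. x v \<noteq> 0} \<subseteq> {v \<in> V. ?F x v \<noteq> 0}" using ext by (auto simp: extends_def)
      then show "{v \<in> V. x v \<noteq> 0} \<subset> {v \<in> V. ?F x v \<noteq> 0}" using v by blast
    qed
  next
    fix x
    have "?\<mu> x \<le> card V" using assms by (intro card_mono) auto
    then show "?\<mu> x \<le> n" using assms by linarith
  qed
  then show ?thesis using fold_spread_fixed[where g = g, OF g] by blast
qed

text \<open>Induction adds the top digit; its contribution is a multiple of every smaller power
  involved, so the lower digits stay as they were.\<close>

lemma digits_surj:
  fixes d :: nat
  assumes "\<And>j. j < k \<Longrightarrow> c j \<le> d"
  shows "\<exists>x < Suc d ^ k. \<forall>j < k. x mod Suc d ^ Suc j div Suc d ^ j = c j"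
  using assms
proof (induction k)
  case (Suc k)
  then obtain x where x: "x < Suc d ^ k" "\<forall>j < k. x mod Suc d ^ Suc j div Suc d ^ j = c j"
    by (auto simp: less_Suc_eq)
  let ?x = "c k * Suc d ^ k + x"
  have "?x < c k * Suc d ^ k + Suc d ^ k" using x by simp
  also have "\<dots> = Suc (c k) * Suc d ^ k" by simp
  also have "\<dots> \<le> Suc d ^ Suc k"
    using Suc.prems[of k] by (simp only: power_Suc) (intro mult_right_mono, auto)
  finally have lt: "?x < Suc d ^ Suc k" .
  have "?x mod Suc d ^ Suc j div Suc d ^ j = c j" if "j < Suc k" for j
  proof (cases "j = k")
    case True
    then show ?thesis using lt x by simp
  next
    case False
    then have "Suc d ^ Suc j dvd Suc d ^ k" using that by (intro le_imp_power_dvd) auto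
    then have "Suc d ^ Suc j dvd c k * Suc d ^ k" by (rule dvd_mult)
    then have "?x mod Suc d ^ Suc j = x mod Suc d ^ Suc j"
      by (metis mod_add_left_eq add_0 dvd_imp_mod_0)
    then show ?thesis using x that False by simp
  qed
  then show ?case using lt by blast
qed simp

text \<open>Both edge lists contain each edge in both orientations, so searches run along directed
  pairs and every endpoint sees all its neighbours as second components. \<open>FS\<close> is
  distinct because lengths of its filtered versions stand for degrees.\<close>

locale instance_lists =
  fixes G H :: "nat graph" and VS WS :: "nat list" and ES FS :: "(nat \<times> nat) list"
  assumes simple: "simple_graph G" "simple_graph H" and sub: "verts H \<subseteq> verts G"
    and VS: "distinct VS" "set VS = verts G" and WS: "distinct WS" "set WS = verts H"
    and ES: "set ES = {(a, b). {a, b} \<in> edges G}"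
    and FS: "distinct FS" "set FS = {(a, b). {a, b} \<in> edges H}"
begin

lemma ES_D: "(a, b) \<in> set ES \<Longrightarrow> a \<in> verts G \<and> b \<in> verts G \<and> a \<noteq> b"
  using simple_graph_edgeD[OF simple(1)] ES by blast

lemma FS_D: "(a, b) \<in> set FS \<Longrightarrow> a \<in> verts H \<and> b \<in> verts H \<and> a \<noteq> b"
  using simple_graph_edgeD[OF simple(2)] FS by blast

text \<open>The filtered length is the degree of \<open>h\<close> in the subgraph induced by
  \<open>A\<close>; some vertex of that subgraph has degree at most the degeneracy.\<close>

lemma le_degeneracy:
  assumes A: "A \<subseteq> verts H" "A \<noteq> {}"
    and c: "\<And>h. h \<in> A \<Longrightarrow> c \<le> length (filter (\<lambda>(a, b). a = h \<and> b \<in> A) FS)"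
  shows "c \<le> degeneracy H"
proof -
  let ?P = "\<lambda>d. \<forall>S. subgraph S H \<and> verts S \<noteq> {} \<longrightarrow> (\<exists>v \<in> verts S. vertex_degree S v \<le> d)"
  have fin: "finite (verts H)" using simple by (simp add: simple_graph_def)
  \<comment> \<open>\<open>LeastI\<close> needs one value with the defining property; no degree
    exceeds the number of vertices.\<close>
  have "?P (card (verts H))"
  proof (intro allI impI)
    fix S assume S: "subgraph S H \<and> verts S \<noteq> {}"
    then obtain v where v: "v \<in> verts S" by blast
    have "nbrs S v \<subseteq> verts S"
      using S simple_graph_edgeD(2) by (fastforce simp: nbrs_def subgraph_def)
    then have "vertex_degree S v \<le> card (verts H)"
      unfolding vertex_degree_def using S fin by (intro card_mono) (auto simp: subgraph_def)
    then show "\<exists>v \<in> verts S. vertex_degree S v \<le> card (verts H)" using v by blast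
  qed
  then have deg: "?P (degeneracy H)" unfolding degeneracy_def by (rule LeastI)
  let ?S = "Graph A {e \<in> edges H. e \<subseteq> A}"
  have "subgraph ?S H"
    using A simple(2) finite_subset[OF A(1) fin] by (auto simp: subgraph_def simple_graph_def)
  then obtain h where h: "h \<in> A" "vertex_degree ?S h \<le> degeneracy H" using deg A by fastforce
  let ?F = "filter (\<lambda>(a, b). a = h \<and> b \<in> A) FS"
  have "nbrs ?S h = snd ` set ?F"
    using h(1) FS by (force simp: nbrs_def)
  moreover have "inj_on snd (set ?F)" by (auto simp: inj_on_def)
  ultimately have "vertex_degree ?S h = card (set ?F)"
    by (simp add: vertex_degree_def card_image)
  also have "\<dots> = length ?F" using FS(1) by (simp add: distinct_card del: set_filter)
  finally show ?thesis using c[OF h(1)] h(2) by simp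
qed

section \<open>Orders of bounded width and the run that follows a given partition\<close>

definition later :: "nat list \<Rightarrow> nat \<Rightarrow> (nat \<times> nat) list" where
  "later X i = filter (\<lambda>(a, b). a = X ! i \<and> b \<notin> set (take i X)) FS"

text \<open>The class of the phase itself plus at most \<open>d\<close> later neighbours: any
  candidate is selected by a digit between 0 and \<open>d\<close>, hence the base
  \<open>d + 1\<close>.\<close>

definition candidates :: "nat list \<Rightarrow> nat \<Rightarrow> nat list" where
  "candidates X i = X ! i # map snd (later X i)"

definition elimination_order :: "nat list \<Rightarrow> nat \<Rightarrow> bool" where
  "elimination_order X d \<longleftrightarrow> distinct X \<and> set X = set WS \<and> (\<forall>i < length X. length (later X i) \<le> d)"

text \<open>
  The digit to be guessed for \<open>v\<close> can be fixed in advance: in the run that follows \<open>\<phi>\<close>, the vertex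
  \<open>v\<close> is coloured in the first phase whose class contains a neighbour of \<open>v\<close>, whatever the order in
  which the edges are visited.
\<close>

definition first_nbr :: "nat list \<Rightarrow> (nat \<Rightarrow> nat) \<Rightarrow> nat \<Rightarrow> nat" where
  "first_nbr X \<phi> v = (LEAST j. j < length X \<and> (\<exists>a. {a, v} \<in> edges G \<and> \<phi> a = X ! j))"

definition guess :: "nat list \<Rightarrow> (nat \<Rightarrow> nat) \<Rightarrow> nat \<Rightarrow> nat" where
  "guess X \<phi> v =
     (let L = candidates X (first_nbr X \<phi> v)
      in if first_nbr X \<phi> v < length X \<and> \<phi> v \<in> set L then (SOME t. t < length L \<and> L ! t = \<phi> v) else 0)"

lemma guess_correct:
  assumes "first_nbr X \<phi> v < length X" "\<phi> v \<in> set (candidates X (first_nbr X \<phi> v))"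
  shows "guess X \<phi> v < length (candidates X (first_nbr X \<phi> v))"
    "candidates X (first_nbr X \<phi> v) ! guess X \<phi> v = \<phi> v"
  using assms someI_ex[OF assms(2)[unfolded in_set_conv_nth]] by (simp_all add: guess_def Let_def)

text \<open>The default value 0 keeps the digit in range even for vertices without a usable guess,
  so the digits of all vertices together form a number in base \<open>d + 1\<close>.\<close>

lemma guess_le: "elimination_order X d \<Longrightarrow> guess X \<phi> v \<le> d"
proof (cases "first_nbr X \<phi> v < length X \<and> \<phi> v \<in> set (candidates X (first_nbr X \<phi> v))")
  case True
  assume X: "elimination_order X d"
  have "guess X \<phi> v < length (candidates X (first_nbr X \<phi> v))" using True guess_correct(1) by blast
  also have "\<dots> \<le> Suc d" using X True by (simp add: elimination_order_def candidates_def)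
  finally show ?thesis by simp
next
  case False
  then show ?thesis by (auto simp: guess_def Let_def)
qed

text \<open>
  The last conjunct says that the classes of the phases before \<open>i\<close> have no uncoloured neighbours.
  As classes are connected, these classes are then coloured completely.
\<close>

definition consistent :: "nat list \<Rightarrow> (nat \<Rightarrow> nat) \<Rightarrow> nat \<Rightarrow> (nat \<Rightarrow> nat) \<Rightarrow> bool" where
  "consistent X \<phi> i col \<longleftrightarrow>
     (\<forall>v. col v \<noteq> 0 \<longrightarrow> col v = Suc (\<phi> v)) \<and> (\<forall>h \<in> verts H. col h = Suc h) \<and>
     (\<forall>j < i. \<forall>(a, b) \<in> set ES. col a = Suc (X ! j) \<longrightarrow> col b \<noteq> 0)"

lemma consistentD:
  assumes "consistent X \<phi> i col"
  shows "col v \<noteq> 0 \<Longrightarrow> col v = Suc (\<phi> v)" "h \<in> verts H \<Longrightarrow> col h = Suc h"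
    "j < i \<Longrightarrow> (a, b) \<in> set ES \<Longrightarrow> col a = Suc (X ! j) \<Longrightarrow> col b \<noteq> 0"
  using assms unfolding consistent_def by blast+

lemma consistent_class:
  assumes \<phi>: "contraction_map G H \<phi>" and X: "elimination_order X d"
    and c: "consistent X \<phi> i col" and j: "j < i" "j < length X" and v: "v \<in> verts G" "\<phi> v = X ! j"
  shows "col v \<noteq> 0"
proof -
  have h: "X ! j \<in> verts H" using X j WS by (auto simp: elimination_order_def)
  have "(same_class G \<phi>)\<^sup>*\<^sup>* (X ! j) v" using \<phi> v by (metis contraction_map_def)
  then have "\<phi> v = \<phi> (X ! j) \<and> col v \<noteq> 0"
  proof (induction rule: rtranclp_induct)
    case base
    then show ?case using c h by (auto simp: consistent_def)
  next
    case (step y z)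
    have "\<phi> (X ! j) = X ! j" using h \<phi> by (simp add: contraction_map_def)
    then have "col y = Suc (X ! j)" using step consistentD(1)[OF c, of y] v(2) by simp
    moreover have "(y, z) \<in> set ES" using step by (simp add: same_class_def ES)
    ultimately have "col z \<noteq> 0" using consistentD(3)[OF c j(1)] by blast
    then show ?case using step by (simp add: same_class_def)
  qed
  then show ?thesis by simp
qed

text \<open>Since \<open>b\<close> is uncoloured, its class is not one of the completed earlier
  ones, so it is \<open>X ! i\<close> or a later neighbour of it, that is, a candidate. Nor is
  \<open>b\<close> adjacent to an earlier class, for then it would be coloured; hence this is the
  phase for which its digit was fixed.\<close>

lemma consistent_step:
  assumes \<phi>: "contraction_map G H \<phi>" and X: "elimination_order X d"
    and c: "consistent X \<phi> i col" and i: "i < length X"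
    and ab: "(a, b) \<in> set ES" "col a = Suc (X ! i)" "col b = 0"
    and L: "\<And>t. t < length (candidates X i) \<Longrightarrow> L t = candidates X i ! t"
  shows "consistent X \<phi> i (col(b := Suc (L (guess X \<phi> b))))"
proof -
  have v: "a \<in> verts G" "b \<in> verts G" "a \<noteq> b" "{a, b} \<in> edges G" using ES_D[OF ab(1)] ab(1) ES by auto
  have dist: "distinct X" "set X = verts H" using X WS by (auto simp: elimination_order_def)
  have \<phi>a: "\<phi> a = X ! i" using consistentD(1)[OF c, of a] ab by simp
  have "\<phi> b \<in> set X" using \<phi> v dist by (auto simp: contraction_map_def)
  then obtain l where l: "l < length X" "\<phi> b = X ! l" by (metis in_set_conv_nth)
  \<comment> \<open>Classes of earlier phases are coloured completely, and \<open>b\<close> is not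
    coloured.\<close>
  have li: "\<not> l < i" using consistent_class[OF \<phi> X c _ l(1) v(2) l(2)] ab by auto
  have cand: "\<phi> b \<in> set (candidates X i)"
  proof (cases "l = i")
    case False
    have "\<phi> a \<noteq> \<phi> b" using False l i dist \<phi>a by (simp add: nth_eq_iff_index_eq)
    then have "{\<phi> a, \<phi> b} \<in> edges H" using \<phi> v unfolding contraction_map_def by blast
    then have "(X ! i, \<phi> b) \<in> set FS" using FS \<phi>a by auto
    moreover have "\<phi> b \<notin> set (take i X)"
    proof
      assume "\<phi> b \<in> set (take i X)"
      then obtain j where "j < i" "\<phi> b = X ! j" by (auto simp: in_set_conv_nth)
      then show False using l i li dist by (simp add: nth_eq_iff_index_eq)
    qed
    ultimately show ?thesis by (force simp: candidates_def later_def)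
  qed (use l in \<open>simp add: candidates_def\<close>)
  \<comment> \<open>The digit of \<open>b\<close> indexes the candidates of the first phase with a
    neighbour of \<open>b\<close>; it must be shown that this is the current phase.\<close>
  have first: "first_nbr X \<phi> b = i"
    unfolding first_nbr_def
  proof (rule Least_equality)
    show "i < length X \<and> (\<exists>a. {a, b} \<in> edges G \<and> \<phi> a = X ! i)" using i v \<phi>a by blast
    fix j assume "j < length X \<and> (\<exists>a. {a, b} \<in> edges G \<and> \<phi> a = X ! j)"
    then obtain a' where j: "j < length X" "{a', b} \<in> edges G" "\<phi> a' = X ! j" by blast
    have E: "(a', b) \<in> set ES" using ES j by simp
    show "i \<le> j"
    proof (rule ccontr)
      assume "\<not> i \<le> j"
      then have nz: "col a' \<noteq> 0" using consistent_class[OF \<phi> X c _ j(1) _ j(3)] ES_D[OF E] by simp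
      then have "col a' = Suc (X ! j)" using consistentD(1)[OF c nz] j by simp
      then show False using consistentD(3)[OF c _ E, of j] \<open>\<not> i \<le> j\<close> ab(3) by linarith
    qed
  qed
  let ?col = "col(b := Suc (L (guess X \<phi> b)))"
  have Lb: "L (guess X \<phi> b) = \<phi> b"
    using guess_correct[of X \<phi> b] L[of "guess X \<phi> b"] first i cand by simp
  have bH: "b \<notin> verts H" using consistentD(2)[OF c, of b] ab(3) by auto
  \<comment> \<open>The new vertex joins no earlier class, so it imposes no closure condition on its
    own neighbours.\<close>
  have bj: "\<phi> b \<noteq> X ! j" if "j < i" for j
    using that l i li dist by (simp add: nth_eq_iff_index_eq)
  show ?thesis
    unfolding consistent_def
  proof (intro conjI allI impI ballI)
    fix v assume "?col v \<noteq> 0"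
    then show "?col v = Suc (\<phi> v)" using consistentD(1)[OF c, of v] Lb by (cases "v = b") simp_all
  next
    fix h assume "h \<in> verts H"
    then show "?col h = Suc h" using consistentD(2)[OF c, of h] bH by (cases "h = b") simp_all
  next
    fix j e assume j: "j < i" and e: "e \<in> set ES"
    obtain x y where xy: "e = (x, y)" by force
    have "?col y \<noteq> 0" if "?col x = Suc (X ! j)"
    proof (cases "x = b")
      case True
      then show ?thesis using that bj[OF j] Lb by simp
    next
      case False
      then show ?thesis using consistentD(3)[OF c j, of x y] e xy that by (cases "y = b") simp_all
    qed
    then show "case e of (x, y) \<Rightarrow> ?col x = Suc (X ! j) \<longrightarrow> ?col y \<noteq> 0" by (simp add: xy)
  qed
qed

text \<open>Consistency survives every single colouring, and after \<open>length VS\<close> sweeps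
  the class of phase \<open>i\<close> is closed as well. The values of \<open>g\<close> on
  \<open>verts H\<close> do not enter, as these vertices are coloured from the start.\<close>

lemma consistent_phase:
  assumes \<phi>: "contraction_map G H \<phi>" and X: "elimination_order X d"
    and c: "consistent X \<phi> i col" and i: "i < length X"
    and L: "\<And>t. t < length (candidates X i) \<Longrightarrow> L t = candidates X i ! t"
    and g: "\<And>b. b \<in> verts G - verts H \<Longrightarrow> g b = Suc (L (guess X \<phi> b))" "\<And>b. g b \<noteq> 0"
    and P: "\<And>x a b. P x a b \<longleftrightarrow> x = Suc (X ! i)"
  shows "consistent X \<phi> (Suc i) ((fold (spread P g) ES ^^ length VS) col)" (is "consistent _ _ _ ?r")
proof -
  have "consistent X \<phi> i ?r"
  proof (rule funpow_spread_induct[where Q = "consistent X \<phi> i"])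
    fix r a b assume r: "consistent X \<phi> i r" "(a, b) \<in> set ES" "P (r a) a b" "r b = 0"
    then have "b \<in> verts G - verts H" using ES_D[OF r(2)] by (auto simp: consistent_def)
    then show "consistent X \<phi> i (r(b := g b))"
      using consistent_step[OF \<phi> X r(1) i r(2) _ r(4) L] r(3) P g by simp
  qed (rule c)
  moreover have "\<forall>(a, b) \<in> set ES. P (?r a) a b \<longrightarrow> ?r b \<noteq> 0"
    using VS ES_D by (intro funpow_spread_closed[where V = "verts G"] g(2)) (auto simp: distinct_card simp flip: VS(2))
  ultimately show ?thesis unfolding consistent_def P by (auto simp: less_Suc_eq)
qed

lemma consistent_final:
  assumes \<phi>: "contraction_map G H \<phi>" and X: "elimination_order X d"
    and c: "consistent X \<phi> (length X) col" and v: "v \<in> verts G"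
  shows "col v = Suc (\<phi> v)"
proof -
  have "\<phi> v \<in> set X" using \<phi> v X WS by (auto simp: contraction_map_def elimination_order_def)
  then obtain l where l: "l < length X" "\<phi> v = X ! l" by (metis in_set_conv_nth)
  have "col v \<noteq> 0" using consistent_class[OF \<phi> X c l(1) l(1) v l(2)] .
  then show ?thesis using c by (auto simp: consistent_def)
qed

text \<open>One search from all labels of \<open>H\<close> at once tests the connectivity of every
  class, because requiring equal colours keeps the searches apart.\<close>

definition reach :: "(nat \<Rightarrow> nat) \<Rightarrow> (nat \<Rightarrow> nat) \<Rightarrow> nat \<Rightarrow> nat" where
  "reach col r = (fold (spread (\<lambda>x a b. x = 1 \<and> col a = col b) (\<lambda>_. 1)) ES ^^ length VS) r"

definition accepts :: "(nat \<Rightarrow> nat) \<Rightarrow> (nat \<Rightarrow> nat) \<Rightarrow> bool" where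
  "accepts col r \<longleftrightarrow> (\<forall>v \<in> set VS. r v \<noteq> 0) \<and>
     (\<forall>(a, b) \<in> set ES. col a \<noteq> col b \<longrightarrow> (\<exists>(x, y) \<in> set FS. col a = Suc x \<and> col b = Suc y)) \<and>
     (\<forall>(x, y) \<in> set FS. \<exists>(a, b) \<in> set ES. col a = Suc x \<and> col b = Suc y)"

text \<open>A reached vertex has the colour of the label from which it was reached. So the
  reachability test also rules out uncoloured vertices and colours that belong to no vertex of
  \<open>H\<close>, whatever produced \<open>col\<close>.\<close>

lemma accepts_sound:
  assumes col: "\<And>h. h \<in> verts H \<Longrightarrow> col h = Suc h"
    and r: "\<And>v. r v = of_bool (v \<in> verts H)" and acc: "accepts col (reach col r)"
  shows "contraction_map G H (\<lambda>v. col v - 1)"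
proof -
  let ?\<phi> = "\<lambda>v. col v - 1"
  let ?Q = "\<lambda>r::nat \<Rightarrow> nat. \<forall>v. r v \<noteq> 0 \<longrightarrow> (\<exists>h \<in> verts H. (same_class G col)\<^sup>*\<^sup>* h v)"
  have "?Q (reach col r)" unfolding reach_def
  proof (rule funpow_spread_induct[where Q = ?Q])
    show "?Q r" using r by auto
    fix r :: "nat \<Rightarrow> nat" and a b assume *: "?Q r" "(a, b) \<in> set ES" "r a = 1 \<and> col a = col b"
    from *(3) have "r a \<noteq> 0" by simp
    with *(1) obtain h where h: "h \<in> verts H" "(same_class G col)\<^sup>*\<^sup>* h a" by blast
    have "same_class G col a b" using * by (simp add: same_class_def ES)
    with h have "(same_class G col)\<^sup>*\<^sup>* h b" by (meson rtranclp.rtrancl_into_rtrancl)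
    then show "?Q (r(b := 1))" using h *(1) by auto
  qed
  then have conn: "\<exists>h \<in> verts H. (same_class G col)\<^sup>*\<^sup>* h v" if "v \<in> verts G" for v
    using that acc VS by (simp add: accepts_def)
  have lift: "(same_class G ?\<phi>)\<^sup>*\<^sup>* h v \<and> col h = col v" if "(same_class G col)\<^sup>*\<^sup>* h v" for h v
    using that
  proof (induction rule: rtranclp_induct)
    case (step y z)
    then have "same_class G ?\<phi> y z" "col y = col z" by (auto simp: same_class_def)
    then show ?case using step by (metis rtranclp.rtrancl_into_rtrancl)
  qed simp
  have cl: "\<exists>h \<in> verts H. col v = Suc h \<and> (same_class G ?\<phi>)\<^sup>*\<^sup>* h v" if "v \<in> verts G" for v
    using conn[OF that] lift col by metis
  have "{x, y} \<in> edges H \<longleftrightarrow> (\<exists>a b. {a, b} \<in> edges G \<and> ?\<phi> a = x \<and> ?\<phi> b = y)"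
    if xy: "x \<noteq> y" for x y
  proof
    assume "{x, y} \<in> edges H"
    then have "(x, y) \<in> set FS" using FS by simp
    then obtain a b where "(a, b) \<in> set ES" "col a = Suc x" "col b = Suc y"
      using acc by (fastforce simp: accepts_def)
    then show "\<exists>a b. {a, b} \<in> edges G \<and> ?\<phi> a = x \<and> ?\<phi> b = y" using ES
      by (intro exI[of _ a] exI[of _ b]) auto
  next
    assume "\<exists>a b. {a, b} \<in> edges G \<and> ?\<phi> a = x \<and> ?\<phi> b = y"
    then obtain a b where ab: "{a, b} \<in> edges G" "?\<phi> a = x" "?\<phi> b = y" by blast
    then have E: "(a, b) \<in> set ES" using ES by simp
    have "col a \<noteq> col b" using ab xy by auto
    then obtain x' y' where "(x', y') \<in> set FS" "col a = Suc x'" "col b = Suc y'"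
      using acc E by (fastforce simp: accepts_def)
    then show "{x, y} \<in> edges H" using ab FS by auto
  qed
  moreover have "?\<phi> ` verts G \<subseteq> verts H" using cl by fastforce
  moreover have "(same_class G ?\<phi>)\<^sup>*\<^sup>* (?\<phi> v) v" if "v \<in> verts G" for v using cl[OF that] by auto
  ultimately show ?thesis using sub col unfolding contraction_map_def by auto
qed

lemma accepts_complete:
  assumes \<phi>: "contraction_map G H \<phi>" and col: "\<And>v. v \<in> verts G \<Longrightarrow> col v = Suc (\<phi> v)"
    and r: "\<And>v. r v = of_bool (v \<in> verts H)"
  shows "accepts col (reach col r)"
  unfolding accepts_def
proof (intro conjI)
  have clos: "\<forall>(a, b) \<in> set ES. reach col r a = 1 \<and> col a = col b \<longrightarrow> reach col r b \<noteq> 0"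
    unfolding reach_def using VS ES_D
    by (intro funpow_spread_closed[where V = "verts G"]) (auto simp: distinct_card simp flip: VS(2))
  \<comment> \<open>Closure is stated for the value 1 but reachability for nonzero values; the two
    coincide because only 0 and 1 occur.\<close>
  let ?Q = "\<lambda>r::nat \<Rightarrow> nat. \<forall>v. r v \<noteq> 0 \<longrightarrow> r v = 1"
  have one: "?Q (reach col r)" unfolding reach_def
    by (rule funpow_spread_induct[where Q = ?Q]) (use r in auto)
  have ext: "extends r (reach col r)" unfolding reach_def by (rule extends_funpow_spread)
  show "\<forall>v \<in> set VS. reach col r v \<noteq> 0"
  proof
    fix v assume "v \<in> set VS"
    then have path: "(same_class G \<phi>)\<^sup>*\<^sup>* (\<phi> v) v" and h: "\<phi> v \<in> verts H"
      using \<phi> VS by (auto simp: contraction_map_def)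
    from path show "reach col r v \<noteq> 0"
    proof (induction rule: rtranclp_induct)
      case base
      have "r (\<phi> v) \<noteq> 0" using h by (simp add: r)
      then show ?case using ext unfolding extends_def by metis
    next
      case (step y z)
      then have E: "(y, z) \<in> set ES" "\<phi> y = \<phi> z" by (auto simp: same_class_def ES)
      then have "col y = col z" using col ES_D[OF E(1)] by simp
      moreover have "reach col r y = 1" using one step by blast
      ultimately show ?case using clos E by blast
    qed
  qed
  show "\<forall>(a, b) \<in> set ES. col a \<noteq> col b \<longrightarrow> (\<exists>(x, y) \<in> set FS. col a = Suc x \<and> col b = Suc y)"
  proof (clarify)
    fix a b assume ab: "(a, b) \<in> set ES" "col a \<noteq> col b"
    then have e: "col a = Suc (\<phi> a)" "col b = Suc (\<phi> b)" "{a, b} \<in> edges G"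
      using ES_D[OF ab(1)] col ES by auto
    then have "{\<phi> a, \<phi> b} \<in> edges H" using \<phi> ab unfolding contraction_map_def by metis
    then show "\<exists>(x, y) \<in> set FS. col a = Suc x \<and> col b = Suc y"
      using e FS by (intro bexI[of _ "(\<phi> a, \<phi> b)"]) auto
  qed
  show "\<forall>(x, y) \<in> set FS. \<exists>(a, b) \<in> set ES. col a = Suc x \<and> col b = Suc y"
  proof clarify
    fix x y assume xy: "(x, y) \<in> set FS"
    then have "{x, y} \<in> edges H" "x \<noteq> y" using FS FS_D by auto
    then obtain a b where ab: "{a, b} \<in> edges G" "\<phi> a = x" "\<phi> b = y"
      using \<phi> unfolding contraction_map_def by blast
    then have "(a, b) \<in> set ES" using ES by simp
    then show "\<exists>(a, b) \<in> set ES. col a = Suc x \<and> col b = Suc y"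
      using ab ES_D[of a b] col by (intro bexI[of _ "(a, b)"]) auto
  qed
qed

end

section \<open>The program\<close>

text \<open>
  Labels serve directly as array indices.  Scalars: \<open>n\<close> and \<open>p\<close> count the vertices of \<open>G\<close> and \<open>H\<close>,
  \<open>m\<close> and \<open>q\<close> their edges in both orientations, \<open>k\<close> the vertices of \<open>G\<close> outside \<open>H\<close>; \<open>d\<close> is the
  width of the elimination order, \<open>N\<close> the number of guesses and \<open>x\<close> the current guess.
  Arrays: \<open>v\<close>, \<open>w\<close>, \<open>u\<close> list the vertices of \<open>G\<close>, of \<open>H\<close> and of \<open>G\<close> outside \<open>H\<close>; \<open>a\<close>, \<open>b\<close> and \<open>f\<close>,
  \<open>g\<close> hold the edge endpoints of \<open>G\<close> and \<open>H\<close>; \<open>o\<close> is the elimination order, \<open>z\<close> its inverse and \<open>X\<close>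
  marks the eliminated vertices; \<open>P\<close> holds the powers of \<open>d + 1\<close>, \<open>c\<close> the guessed digits, \<open>L\<close> the
  candidate colours of a phase, \<open>C\<close> the colours (a label plus one, or 0) and \<open>R\<close> the vertices
  reached in the connectivity test.
\<close>

lemma den_all_loop:
  assumes "K \<noteq> x" "\<And>i t. i < s y 0 \<Longrightarrow> t x 0 = i \<Longrightarrow> (\<And>z. z \<notin> wr (For x y p) \<Longrightarrow> t z = s z) \<Longrightarrow>
      den p t K 0 = (if Q i then t K 0 else 0)"
  shows "den (For x y p) s K 0 = (if \<forall>i < s y 0. Q i then s K 0 else 0)"
proof -
  let ?I = "\<lambda>i t. t K 0 = (if \<forall>j < i. Q j then s K 0 else 0)"
  have "?I (s y 0) (den (For x y p) s)"
    by (rule for_inv[where I = ?I]) (use assms in \<open>auto simp: less_Suc_eq\<close>)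
  then show ?thesis .
qed

lemma den_flag_loop:
  assumes "F \<noteq> x" "\<And>i t. i < s y 0 \<Longrightarrow> t x 0 = i \<Longrightarrow> (\<And>z. z \<notin> {x, F} \<Longrightarrow> t z = s z) \<Longrightarrow> bval b t = Q i"
  shows "den (For x y (Cond b (Set F (Const c)))) s F 0 = (if \<exists>i < s y 0. Q i then c else s F 0)"
proof -
  let ?I = "\<lambda>i t. t F 0 = (if \<exists>j < i. Q j then c else s F 0)"
  have "?I (s y 0) (den (For x y (Cond b (Set F (Const c)))) s)"
  proof (rule for_inv[where I = ?I])
    fix i t assume *: "i < s y 0" "t x 0 = i" "\<And>z. z \<notin> wr (For x y (Cond b (Set F (Const c)))) \<Longrightarrow> t z = s z"
      "t F 0 = (if \<exists>j < i. Q j then c else s F 0)"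
    have "bval b t = Q i" using * by (intro assms(2)) auto
    then show "put x (Suc i) (den (Cond b (Set F (Const c))) t) F 0 = (if \<exists>j < Suc i. Q j then c else s F 0)"
      using *(4) assms(1) by (auto simp: less_Suc_eq)
  qed (use assms in auto)
  then show ?thesis .
qed

definition spread_prog :: "string \<Rightarrow> bexp \<Rightarrow> aexp \<Rightarrow> loop" where
  "spread_prog A b e = For ''j'' ''n'' (For ''l'' ''m''
     (Cond (Conj b (Equal (Read A (Read ''b'' (Var ''l''))) (Const 0))) (Asg A (Read ''b'' (Var ''l'')) e)))"

lemma spread_prog_simps [simp]:
  "wr (spread_prog A b e) = {''j'', ''l'', A}" "bds (spread_prog A b e) = {''n'', ''m''}"
  "A \<noteq> ''j'' \<Longrightarrow> A \<noteq> ''l'' \<Longrightarrow> wf_loop (spread_prog A b e)"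
  by (auto simp: spread_prog_def)

text \<open>The guard may depend on the array being filled only through its value at the source of
  the edge; everything else that it reads is frozen during the search.\<close>

lemma den_spread_prog:
  assumes A: "A \<notin> {''j'', ''l'', ''b'', ''n'', ''m''}"
    and m: "s ''m'' 0 = length E" "\<And>l. l < length E \<Longrightarrow> s ''b'' l = snd (E ! l)"
    and step: "\<And>l t. l < length E \<Longrightarrow> t ''l'' 0 = l \<Longrightarrow> (\<And>z. z \<notin> {''j'', ''l'', A} \<Longrightarrow> t z = s z) \<Longrightarrow>
       bval b t = P (t A (fst (E ! l))) (fst (E ! l)) (snd (E ! l)) \<and> aval e t = g (snd (E ! l))"
  shows "den (spread_prog A b e) s A = (fold (spread P g) E ^^ s ''n'' 0) (s A)"
proof -
  let ?B = "Cond (Conj b (Equal (Read A (Read ''b'' (Var ''l''))) (Const 0))) (Asg A (Read ''b'' (Var ''l'')) e)"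
  let ?I = "\<lambda>i t. t A = (fold (spread P g) E ^^ i) (s A)"
  have "?I (s ''n'' 0) (den (spread_prog A b e) s)"
    unfolding spread_prog_def
  proof (rule for_inv[where I = ?I])
    show "put ''j'' 0 s A = (fold (spread P g) E ^^ 0) (s A)" using A by simp
    fix i t assume t: "\<And>z. z \<notin> wr (For ''j'' ''n'' (For ''l'' ''m'' ?B)) \<Longrightarrow> t z = s z"
      and I: "t A = (fold (spread P g) E ^^ i) (s A)"
    have m': "t ''m'' 0 = length E" using t[of "''m''"] m(1) A by auto
    let ?J = "\<lambda>l t'. t' A = fold (spread P g) (take l E) (t A)"
    have "?J (t ''m'' 0) (den (For ''l'' ''m'' ?B) t)"
    proof (rule for_inv[where I = ?J])
      show "put ''l'' 0 t A = fold (spread P g) (take 0 E) (t A)" using A by simp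
      fix l t' assume l: "l < t ''m'' 0" and l': "t' ''l'' 0 = l"
        and t': "\<And>z. z \<notin> wr (For ''l'' ''m'' ?B) \<Longrightarrow> t' z = t z"
        and I': "t' A = fold (spread P g) (take l E) (t A)"
      have len: "l < length E" using l m' by simp
      have fr: "t' z = s z" if "z \<notin> {''j'', ''l'', A}" for z using that t t' by simp
      have b: "t' ''b'' l = snd (E ! l)" using fr[of "''b''"] A m(2)[OF len] by auto
      have "den ?B t' A = spread P g (E ! l) (t' A)"
        using step[OF len l' fr] b l' by (auto simp: spread_def split: prod.split)
      then show "put ''l'' (Suc l) (den ?B t') A = fold (spread P g) (take (Suc l) E) (t A)"
        using A I' len by (simp add: take_Suc_conv_app_nth)
    qed
    then have "den (For ''l'' ''m'' ?B) t A = fold (spread P g) E (t A)" using m' by simp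
    then show "put ''j'' (Suc i) (den (For ''l'' ''m'' ?B) t) A = (fold (spread P g) E ^^ Suc i) (s A)"
      using A I by simp
  qed
  then show ?thesis .
qed

definition loaded :: "nat list \<Rightarrow> (nat \<times> nat) list \<Rightarrow> nat list \<Rightarrow> (nat \<times> nat) list \<Rightarrow> memory \<Rightarrow> bool" where
  "loaded VS ES WS FS s \<longleftrightarrow>
     s ''n'' 0 = length VS \<and> (\<forall>i < length VS. s ''v'' i = VS ! i) \<and>
     s ''m'' 0 = length ES \<and> (\<forall>i < length ES. s ''a'' i = fst (ES ! i) \<and> s ''b'' i = snd (ES ! i)) \<and>
     s ''p'' 0 = length WS \<and> (\<forall>i < length WS. s ''w'' i = WS ! i) \<and>
     s ''q'' 0 = length FS \<and> (\<forall>i < length FS. s ''f'' i = fst (FS ! i) \<and> s ''g'' i = snd (FS ! i)) \<and>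
     s ''k'' 0 = length (filter (\<lambda>v. v \<notin> set WS) VS) \<and>
     (\<forall>i < s ''k'' 0. s ''u'' i = filter (\<lambda>v. v \<notin> set WS) VS ! i)"

lemma loaded_cong:
  assumes "\<And>z. z \<in> {''n'', ''v'', ''m'', ''a'', ''b'', ''p'', ''w'', ''q'', ''f'', ''g'', ''k'', ''u''} \<Longrightarrow> s' z = s z"
  shows "loaded VS ES WS FS s' = loaded VS ES WS FS s"
  using assms by (simp add: loaded_def)

definition count_prog :: loop where
  "count_prog = Set ''D'' (Const 0) ;;
     For ''l'' ''q'' (Cond (Conj (Equal (Read ''f'' (Var ''l'')) (Var ''y''))
         (Equal (Read ''X'' (Read ''g'' (Var ''l''))) (Const 0)))
       (Set ''D'' (Plus (Var ''D'') (Const 1))))"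

text \<open>The initial value \<open>q + 1\<close> exceeds every count, as a count is at most
  \<open>q\<close>; the first remaining vertex therefore always replaces it.\<close>

definition min_prog :: loop where
  "min_prog = Set ''B'' (Plus (Var ''q'') (Const 1)) ;;
     For ''j'' ''p'' (Set ''y'' (Read ''w'' (Var ''j'')) ;;
       Cond (Equal (Read ''X'' (Var ''y'')) (Const 0)) (count_prog ;;
         Cond (Less (Var ''D'') (Var ''B'')) (Set ''B'' (Var ''D'') ;; Set ''e'' (Var ''y''))))"

definition order_prog :: loop where
  "order_prog = For ''i'' ''p'' (min_prog ;;
     Asg ''o'' (Var ''i'') (Var ''e'') ;; Asg ''z'' (Var ''e'') (Var ''i'') ;;
     Asg ''X'' (Var ''e'') (Const 1) ;; Cond (Less (Var ''d'') (Var ''B'')) (Set ''d'' (Var ''B'')))"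

lemma order_prog_simps [simp]:
  "wr count_prog = {''D'', ''l''}" "bds count_prog = {''q''}" "wf_loop count_prog"
  "wr min_prog = {''B'', ''j'', ''y'', ''D'', ''l'', ''e''}" "bds min_prog = {''p'', ''q''}" "wf_loop min_prog"
  "wr order_prog = {''i'', ''B'', ''j'', ''y'', ''D'', ''l'', ''e'', ''o'', ''z'', ''X'', ''d''}"
  "bds order_prog = {''p'', ''q''}" "wf_loop order_prog"
  by (auto simp: count_prog_def min_prog_def order_prog_def)

section \<open>Computing an order of width at most the degeneracy\<close>

context instance_lists
begin

abbreviation "loaded_mem \<equiv> loaded VS ES WS FS"

lemma den_count_prog:
  assumes s: "loaded_mem s" and X: "\<And>h. h \<in> verts H \<Longrightarrow> s ''X'' h = of_bool (h \<notin> A)"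
  shows "den count_prog s ''D'' 0 = length (filter (\<lambda>(a, b). a = s ''y'' 0 \<and> b \<in> A) FS)"
proof -
  let ?P = "\<lambda>(a, b). a = s ''y'' 0 \<and> b \<in> A"
  let ?c = "Conj (Equal (Read ''f'' (Var ''l'')) (Var ''y''))
         (Equal (Read ''X'' (Read ''g'' (Var ''l''))) (Const 0))"
  let ?b = "Cond ?c (Set ''D'' (Plus (Var ''D'') (Const 1)))"
  let ?s = "den (Set ''D'' (Const 0)) s"
  have s': "?s ''q'' 0 = length FS" using s by (simp add: loaded_def)
  let ?I = "\<lambda>l t. t ''D'' 0 = length (filter ?P (take l FS))"
  have "?I (?s ''q'' 0) (den (For ''l'' ''q'' ?b) ?s)"
  proof (rule for_inv[where I = ?I])
    fix l t assume l: "l < ?s ''q'' 0" "t ''l'' 0 = l"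
      and fr: "\<And>z. z \<notin> wr (For ''l'' ''q'' ?b) \<Longrightarrow> t z = ?s z"
      and I: "t ''D'' 0 = length (filter ?P (take l FS))"
    have len: "l < length FS" using l s' by simp
    then have "snd (FS ! l) \<in> verts H" using FS_D[of "fst (FS ! l)" "snd (FS ! l)"] by simp
    then have "bval ?c t \<longleftrightarrow> ?P (FS ! l)"
      using s len X[of "snd (FS ! l)"] l(2) by (auto simp: fr loaded_def split: prod.split)
    then have "den ?b t ''D'' 0 = (if ?P (FS ! l) then Suc (t ''D'' 0) else t ''D'' 0)"
      unfolding den.simps(3) by simp
    then show "put ''l'' (Suc l) (den ?b t) ''D'' 0 = length (filter ?P (take (Suc l) FS))"
      unfolding put_simps(2)[of "''D''" "''l''", simplified] using I len
      by (simp add: take_Suc_conv_app_nth del: den.simps)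
  qed simp
  then show ?thesis unfolding count_prog_def den.simps(2) s' by simp
qed

lemma den_min_prog:
  assumes s: "loaded_mem s" and X: "\<And>h. h \<in> verts H \<Longrightarrow> s ''X'' h = of_bool (h \<notin> A)"
    and A: "A \<subseteq> verts H" "A \<noteq> {}"
  defines "c \<equiv> \<lambda>h. length (filter (\<lambda>(a, b). a = h \<and> b \<in> A) FS)" and "s' \<equiv> den min_prog s"
  shows "s' ''e'' 0 \<in> A" "s' ''B'' 0 = c (s' ''e'' 0)" "\<And>h. h \<in> A \<Longrightarrow> s' ''B'' 0 \<le> c h"
proof -
  let ?c = "Cond (Less (Var ''D'') (Var ''B'')) (Set ''B'' (Var ''D'') ;; Set ''e'' (Var ''y''))"
  let ?b = "Set ''y'' (Read ''w'' (Var ''j'')) ;;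
       Cond (Equal (Read ''X'' (Var ''y'')) (Const 0)) (count_prog ;; ?c)"
  let ?s = "den (Set ''B'' (Plus (Var ''q'') (Const 1))) s"
  \<comment> \<open>The first alternative is the state before any vertex of \<open>A\<close> has
    been met, with the sentinel still in \<open>B\<close>.\<close>
  let ?I = "\<lambda>j t. (t ''B'' 0 = Suc (length FS) \<and> set (take j WS) \<inter> A = {} \<or>
      t ''e'' 0 \<in> A \<and> t ''B'' 0 = c (t ''e'' 0)) \<and> (\<forall>h \<in> set (take j WS) \<inter> A. t ''B'' 0 \<le> c h)"
  have I: "?I (?s ''p'' 0) (den (For ''j'' ''p'' ?b) ?s)"
  proof (rule for_inv[where I = ?I])
    show "?I 0 (put ''j'' 0 ?s)" using s by (simp add: loaded_def)
    fix j t assume j: "j < ?s ''p'' 0" "t ''j'' 0 = j"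
      and fr: "\<And>z. z \<notin> wr (For ''j'' ''p'' ?b) \<Longrightarrow> t z = ?s z" and I: "?I j t"
    have len: "j < length WS" using j s by (simp add: loaded_def)
    have w: "t ''w'' j = WS ! j" using s len by (simp add: fr loaded_def)
    have wH: "WS ! j \<in> verts H" using nth_mem[OF len] WS(2) by simp
    define t1 where "t1 = den (Set ''y'' (Read ''w'' (Var ''j''))) t"
    have y: "t1 ''y'' 0 = WS ! j" using w j by (simp add: t1_def)
    have t1: "t1 z = t z" if "z \<noteq> ''y''" for z using that by (simp add: t1_def)
    define r where "r = den ?b t"
    have r: "r = den (Cond (Equal (Read ''X'' (Var ''y'')) (Const 0)) (count_prog ;; ?c)) t1"
      by (simp only: r_def t1_def den.simps(2))
    have tk: "set (take (Suc j) WS) = insert (WS ! j) (set (take j WS))"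
      using len by (simp add: take_Suc_conv_app_nth)
    have Xt: "t ''X'' h = of_bool (h \<notin> A)" if "h \<in> verts H" for h using X that by (simp add: fr)
    have "?I (Suc j) r"
    proof (cases "WS ! j \<in> A")
      case False
      then have "r = t1" unfolding r den.simps(3) using Xt[OF wH] y by (simp add: t1)
      then show ?thesis using I False unfolding tk by (simp add: t1)
    next
      case True
      have l: "loaded_mem t1" using s by (subst loaded_cong[of _ s]) (auto simp: fr t1)
      define u where "u = den count_prog t1"
      have D: "u ''D'' 0 = c (WS ! j)"
        using den_count_prog[OF l, of A] y Xt by (simp add: c_def u_def t1)
      have u: "u ''B'' 0 = t ''B'' 0" "u ''e'' 0 = t ''e'' 0" "u ''y'' 0 = WS ! j"
        using y by (simp_all add: den_frame u_def t1)
      have "r = den ?c u"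
        unfolding r den.simps(3) u_def using True Xt[OF wH] y by (simp add: t1)
      then have "r ''B'' 0 = (if c (WS ! j) < t ''B'' 0 then c (WS ! j) else t ''B'' 0)"
        "r ''e'' 0 = (if c (WS ! j) < t ''B'' 0 then WS ! j else t ''e'' 0)"
        using D u by auto
      moreover have "c (WS ! j) < Suc (length FS)" by (simp add: c_def less_Suc_eq_le)
      ultimately show ?thesis using I True unfolding tk
        by (auto intro: order_trans[OF less_imp_le])
    qed
    then show "?I (Suc j) (put ''j'' (Suc j) (den ?b t))" unfolding r_def[symmetric] by simp
  qed
  have p: "?s ''p'' 0 = length WS" using s by (simp add: loaded_def)
  have s': "den (For ''j'' ''p'' ?b) ?s = s'"
    by (simp only: s'_def min_prog_def den.simps(2))
  have "set (take (length WS) WS) \<inter> A = A" using A WS by auto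
  from I[unfolded p s' this] have "(s' ''B'' 0 = Suc (length FS) \<and> A = {} \<or> s' ''e'' 0 \<in> A \<and> s' ''B'' 0 = c (s' ''e'' 0)) \<and>
      (\<forall>h \<in> A. s' ''B'' 0 \<le> c h)" .
  then show "s' ''e'' 0 \<in> A" "s' ''B'' 0 = c (s' ''e'' 0)" "\<And>h. h \<in> A \<Longrightarrow> s' ''B'' 0 \<le> c h"
    using A(2) by blast+
qed

definition ordered :: "nat list \<Rightarrow> memory \<Rightarrow> bool" where
  "ordered X s \<longleftrightarrow> (\<forall>j < length X. s ''o'' j = X ! j \<and> s ''z'' (X ! j) = j)"

lemma later_append: "j < length X \<Longrightarrow> later (X @ [h]) j = later X j"
  by (simp add: later_def nth_append)

text \<open>Each round appends a vertex of minimum degree among the remaining ones, and this minimum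
  is bounded by \<open>le_degeneracy\<close>. The second bound, by \<open>length FS\<close>, serves
  the running time, where \<open>d\<close> is itself a loop limit.\<close>

lemma den_order_prog:
  assumes s: "loaded_mem s" "\<And>h. s ''X'' h = 0" "s ''d'' 0 = 0"
  defines "s' \<equiv> den order_prog s"
  shows "\<exists>X. ordered X s' \<and> elimination_order X (s' ''d'' 0) \<and> s' ''d'' 0 \<le> degeneracy H \<and>
    s' ''d'' 0 \<le> length FS"
proof -
  let ?u = "Asg ''o'' (Var ''i'') (Var ''e'') ;; Asg ''z'' (Var ''e'') (Var ''i'') ;;
     Asg ''X'' (Var ''e'') (Const 1) ;; Cond (Less (Var ''d'') (Var ''B'')) (Set ''d'' (Var ''B''))"
  let ?J = "\<lambda>i t X. length X = i \<and> distinct X \<and> set X \<subseteq> verts H \<and> ordered X t \<and>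
     (\<forall>h. t ''X'' h = of_bool (h \<in> set X)) \<and> (\<forall>j < i. length (later X j) \<le> t ''d'' 0) \<and>
     t ''d'' 0 \<le> degeneracy H \<and> t ''d'' 0 \<le> length FS"
  let ?I = "\<lambda>i t. \<exists>X. ?J i t X"
  have "?I (s ''p'' 0) s'"
    unfolding s'_def order_prog_def
  proof (rule for_inv[where I = ?I])
    show "?I 0 (put ''i'' 0 s)" using s by (simp add: ordered_def)
    fix i t assume i: "i < s ''p'' 0" "t ''i'' 0 = i"
      and fr: "\<And>z. z \<notin> wr (For ''i'' ''p'' (min_prog ;; ?u)) \<Longrightarrow> t z = s z" and I: "?I i t"
    then obtain X where X: "?J i t X" by blast
    have len: "i < length WS" using i s by (simp add: loaded_def)
    let ?A = "verts H - set X"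
    have "card (set X) < card (verts H)" using X len WS by (metis distinct_card)
    then have ne: "?A \<noteq> {}" using card_mono[of "set X" "verts H"] by fastforce
    have l: "loaded_mem t" using s by (subst loaded_cong[of _ s]) (auto simp: fr)
    let ?t = "den min_prog t"
    define h where "h = ?t ''e'' 0"
    let ?c = "\<lambda>h. length (filter (\<lambda>(a, b). a = h \<and> b \<in> ?A) FS)"
    have m: "h \<in> ?A" "?t ''B'' 0 = ?c h" "\<And>h. h \<in> ?A \<Longrightarrow> ?t ''B'' 0 \<le> ?c h"
      using den_min_prog[OF l, of ?A] X ne unfolding h_def by auto
    have B: "?t ''B'' 0 \<le> degeneracy H" using le_degeneracy[of ?A] ne m(3) by blast
    have B2: "?t ''B'' 0 \<le> length FS" unfolding m(2) by (rule length_filter_le)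
    \<comment> \<open>Neighbours in \<open>FS\<close> lie in \<open>verts H\<close>, so not being
      eliminated already means being in \<open>?A\<close>.\<close>
    have "later (X @ [h]) i = filter (\<lambda>(a, b). a = h \<and> b \<in> ?A) FS"
      unfolding later_def using X FS_D by (intro filter_cong) auto
    then have lat: "length (later (X @ [h]) i) = ?t ''B'' 0" using m(2) by simp
    have fr': "?t z = t z" if "z \<notin> {''B'', ''j'', ''y'', ''D'', ''l'', ''e''}" for z
      using that by (simp add: den_frame)
    define w where "w = den ?u ?t"
    have w: "w ''o'' = (t ''o'')(i := h)" "w ''z'' = (t ''z'')(h := i)" "w ''X'' = (t ''X'')(h := 1)"
      "w ''d'' 0 = max (t ''d'' 0) (?t ''B'' 0)"
      unfolding w_def using i by (auto simp: fr' h_def max_def)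
    have "?J (Suc i) (put ''i'' (Suc i) w) (X @ [h])"
    proof (intro conjI allI impI)
      have "X ! j \<noteq> h" if "j < i" for j using that X m(1) by auto
      then show "ordered (X @ [h]) (put ''i'' (Suc i) w)"
        using X unfolding ordered_def by (auto simp: w nth_append less_Suc_eq)
      fix j assume "j < Suc i"
      then show "length (later (X @ [h]) j) \<le> put ''i'' (Suc i) w ''d'' 0"
        using X lat later_append[of j X h] by (cases "j = i") (auto simp: w less_Suc_eq le_max_iff_disj)
    qed (use X m(1) B B2 in \<open>auto simp: w\<close>)
    moreover have "w = den (min_prog ;; ?u) t" by (simp add: w_def)
    ultimately show "?I (Suc i) (put ''i'' (Suc i) (den (min_prog ;; ?u) t))" by metis
  qed
  then obtain X where X: "?J (length WS) s' X" using s by (auto simp: loaded_def)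
  then have "set X = verts H" using WS
    by (metis List.finite_set card_subset_eq distinct_card)
  then show ?thesis using X WS by (intro exI[of _ X]) (auto simp: elimination_order_def)
qed

end

lemma ex_set_conv_ex_nth: "(\<exists>x \<in> set xs. P x) \<longleftrightarrow> (\<exists>i < length xs. P (xs ! i))"
  by (metis in_set_conv_nth)

text \<open>
  Digit \<open>j\<close> of \<open>x\<close> in base \<open>d + 1\<close> belongs to the vertex \<open>u ! j\<close>.  In the absence of division the
  digits are found from the top by repeated subtraction.
\<close>

definition digit_prog :: loop where
  "digit_prog = Set ''D'' (Const 0) ;;
     For ''l'' ''d'' (Cond (Neg (Less (Var ''y'') (Read ''P'' (Minus (Var ''k'') (Plus (Var ''j'') (Const 1))))))
       (Set ''y'' (Minus (Var ''y'') (Read ''P'' (Minus (Var ''k'') (Plus (Var ''j'') (Const 1))))) ;;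
        Set ''D'' (Plus (Var ''D'') (Const 1))))"

definition decode_prog :: loop where
  "decode_prog = Set ''y'' (Var ''x'') ;;
     For ''j'' ''k'' (digit_prog ;; Asg ''c'' (Read ''u'' (Minus (Var ''k'') (Plus (Var ''j'') (Const 1)))) (Var ''D''))"

definition init_prog :: loop where
  "init_prog = For ''j'' ''n'' (Asg ''C'' (Read ''v'' (Var ''j'')) (Const 0) ;;
       Asg ''R'' (Read ''v'' (Var ''j'')) (Const 0)) ;;
     For ''j'' ''p'' (Asg ''C'' (Read ''w'' (Var ''j'')) (Plus (Read ''w'' (Var ''j'')) (Const 1)) ;;
       Asg ''R'' (Read ''w'' (Var ''j'')) (Const 1))"

text \<open>
  Cells of \<open>L\<close> beyond the current candidates keep values from earlier phases.  A guess that selects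
  one of them is harmless, since a colouring is verified before it is accepted.
\<close>

definition candidates_prog :: loop where
  "candidates_prog = Set ''y'' (Read ''o'' (Var ''i'')) ;; Set ''L'' (Var ''y'') ;; Set ''D'' (Const 1) ;;
     For ''l'' ''q'' (Cond (Conj (Equal (Read ''f'' (Var ''l'')) (Var ''y''))
         (Neg (Less (Read ''z'' (Read ''g'' (Var ''l''))) (Var ''i''))))
       (Asg ''L'' (Var ''D'') (Read ''g'' (Var ''l'')) ;; Set ''D'' (Plus (Var ''D'') (Const 1))))"

definition phase_prog :: loop where
  "phase_prog = candidates_prog ;;
     spread_prog ''C'' (Equal (Read ''C'' (Read ''a'' (Var ''l''))) (Plus (Var ''y'') (Const 1)))
       (Plus (Read ''L'' (Read ''c'' (Read ''b'' (Var ''l'')))) (Const 1))"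

definition reach_prog :: loop where
  "reach_prog = spread_prog ''R'' (Conj (Equal (Read ''R'' (Read ''a'' (Var ''l''))) (Const 1))
       (Equal (Read ''C'' (Read ''a'' (Var ''l''))) (Read ''C'' (Read ''b'' (Var ''l''))))) (Const 1)"

definition match_test :: "string \<Rightarrow> string \<Rightarrow> bexp" where
  "match_test e f = Conj
     (Equal (Read ''C'' (Read ''a'' (Var e))) (Plus (Read ''f'' (Var f)) (Const 1)))
     (Equal (Read ''C'' (Read ''b'' (Var e))) (Plus (Read ''g'' (Var f)) (Const 1)))"

definition all_reached_prog :: loop where
  "all_reached_prog = For ''j'' ''n'' (Cond (Equal (Read ''R'' (Read ''v'' (Var ''j''))) (Const 0)) (Set ''K'' (Const 0)))"

definition edges_into_prog :: loop where
  "edges_into_prog = For ''j'' ''m''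
     (Cond (Neg (Equal (Read ''C'' (Read ''a'' (Var ''j''))) (Read ''C'' (Read ''b'' (Var ''j'')))))
       (Set ''F'' (Const 0) ;; For ''l'' ''q'' (Cond (match_test ''j'' ''l'') (Set ''F'' (Const 1))) ;;
        Cond (Equal (Var ''F'') (Const 0)) (Set ''K'' (Const 0))))"

definition edges_onto_prog :: loop where
  "edges_onto_prog = For ''j'' ''q''
     (Set ''F'' (Const 0) ;; For ''l'' ''m'' (Cond (match_test ''l'' ''j'') (Set ''F'' (Const 1))) ;;
      Cond (Equal (Var ''F'') (Const 0)) (Set ''K'' (Const 0)))"

definition check_prog :: loop where
  "check_prog = Set ''K'' (Const 1) ;; all_reached_prog ;; edges_into_prog ;; edges_onto_prog"

definition body_prog :: loop where
  "body_prog = decode_prog ;; init_prog ;; For ''i'' ''p'' phase_prog ;; reach_prog ;; check_prog ;;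
     Cond (Equal (Var ''K'') (Const 1)) (Set ''out'' (Const 1))"

lemma body_simps [simp]:
  "wr digit_prog = {''D'', ''l'', ''y''}" "bds digit_prog = {''d''}" "wf_loop digit_prog"
  "wr decode_prog = {''y'', ''j'', ''D'', ''l'', ''c''}" "bds decode_prog = {''k'', ''d''}" "wf_loop decode_prog"
  "wr init_prog = {''j'', ''C'', ''R''}" "bds init_prog = {''n'', ''p''}" "wf_loop init_prog"
  "wr candidates_prog = {''y'', ''L'', ''D'', ''l''}" "bds candidates_prog = {''q''}" "wf_loop candidates_prog"
  "wr phase_prog = {''y'', ''L'', ''D'', ''l'', ''j'', ''C''}" "bds phase_prog = {''q'', ''n'', ''m''}" "wf_loop phase_prog"
  "wr reach_prog = {''j'', ''l'', ''R''}" "bds reach_prog = {''n'', ''m''}" "wf_loop reach_prog"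
  "wr all_reached_prog = {''j'', ''K''}" "bds all_reached_prog = {''n''}" "wf_loop all_reached_prog"
  "wr edges_into_prog = {''j'', ''F'', ''l'', ''K''}" "bds edges_into_prog = {''m'', ''q''}" "wf_loop edges_into_prog"
  "wr edges_onto_prog = {''j'', ''F'', ''l'', ''K''}" "bds edges_onto_prog = {''m'', ''q''}" "wf_loop edges_onto_prog"
  "wr check_prog = {''j'', ''F'', ''l'', ''K''}" "bds check_prog = {''n'', ''m'', ''q''}" "wf_loop check_prog"
  "wr body_prog = {''y'', ''j'', ''D'', ''l'', ''c'', ''C'', ''R'', ''L'', ''i'', ''F'', ''K'', ''out''}"
  "bds body_prog = {''k'', ''d'', ''n'', ''p'', ''m'', ''q''}" "wf_loop body_prog"
  by (auto simp: digit_prog_def decode_prog_def init_prog_def candidates_prog_def phase_prog_def reach_prog_def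
      all_reached_prog_def edges_into_prog_def edges_onto_prog_def check_prog_def body_prog_def)

text \<open>The quotient is at most \<open>d\<close> because \<open>y\<close> is below
  \<open>(d + 1) Q\<close>, so \<open>d\<close> conditional subtractions suffice; rounds after the
  last successful one change nothing.\<close>

lemma den_digit_prog:
  assumes "s ''d'' 0 = d" "Q = s ''P'' (s ''k'' 0 - Suc (s ''j'' 0))" "Q > 0" "s ''y'' 0 < Suc d * Q"
  shows "den digit_prog s ''D'' 0 = s ''y'' 0 div Q" "den digit_prog s ''y'' 0 = s ''y'' 0 mod Q"
proof -
  let ?b = "Cond (Neg (Less (Var ''y'') (Read ''P'' (Minus (Var ''k'') (Plus (Var ''j'') (Const 1))))))
       (Set ''y'' (Minus (Var ''y'') (Read ''P'' (Minus (Var ''k'') (Plus (Var ''j'') (Const 1))))) ;;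
        Set ''D'' (Plus (Var ''D'') (Const 1)))"
  let ?s = "den (Set ''D'' (Const 0)) s"
  let ?Y = "s ''y'' 0"
  let ?I = "\<lambda>l t. t ''D'' 0 = min l (?Y div Q) \<and> t ''y'' 0 = ?Y - min l (?Y div Q) * Q"
  have I: "?I (?s ''d'' 0) (den (For ''l'' ''d'' ?b) ?s)"
  proof (rule for_inv[where I = ?I])
    fix l t assume fr: "\<And>z. z \<notin> wr (For ''l'' ''d'' ?b) \<Longrightarrow> t z = ?s z" and I: "?I l t"
    have Q: "t ''P'' (t ''k'' 0 - Suc (t ''j'' 0)) = Q" using assms(2) by (simp add: fr)
    have le: "?Y div Q * Q \<le> ?Y" by (rule div_times_less_eq_dividend)
    have step: "Q \<le> ?Y - min l (?Y div Q) * Q \<longleftrightarrow> l < ?Y div Q"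
    proof (cases "l < ?Y div Q")
      case True
      then have "Suc l * Q \<le> ?Y" using le by (meson Suc_leI mult_le_mono1 order_trans)
      then show ?thesis using True by simp
    next
      case False
      then have "?Y - min l (?Y div Q) * Q = ?Y mod Q" by (simp add: minus_div_mult_eq_mod)
      then show ?thesis using False assms(3) by (simp add: not_le)
    qed
    define r where "r = den ?b t"
    have "r ''D'' 0 = (if l < ?Y div Q then Suc (t ''D'' 0) else t ''D'' 0)"
      "r ''y'' 0 = (if l < ?Y div Q then t ''y'' 0 - Q else t ''y'' 0)"
      unfolding r_def using step I Q by (auto simp: not_less)
    then have "?I (Suc l) r" using I by auto
    then show "?I (Suc l) (put ''l'' (Suc l) (den ?b t))" unfolding r_def[symmetric] by simp
  qed simp
  have dle: "?Y div Q \<le> d" using assms(3,4) by (simp add: less_mult_imp_div_less less_Suc_eq_le[symmetric])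
  have d: "?s ''d'' 0 = d" using assms by simp
  have e: "den (For ''l'' ''d'' ?b) ?s = den digit_prog s" by (simp only: digit_prog_def den.simps(2))
  from I[unfolded d e] dle show "den digit_prog s ''D'' 0 = ?Y div Q" "den digit_prog s ''y'' 0 = ?Y mod Q"
    by (simp_all add: min_def minus_div_mult_eq_mod)
qed

text \<open>After \<open>i\<close> rounds \<open>y\<close> holds \<open>x\<close> modulo the power
  with exponent \<open>k - i\<close>, and the \<open>i\<close> top digits are stored. Injectivity of
  \<open>u\<close> prevents a later digit from overwriting an earlier one.\<close>

lemma den_decode_prog:
  assumes d: "s ''d'' 0 = d" and P: "\<And>j. j < s ''k'' 0 \<Longrightarrow> s ''P'' j = Suc d ^ j"
    and x: "s ''x'' 0 < Suc d ^ s ''k'' 0" and u: "inj_on (s ''u'') {..<s ''k'' 0}" and j: "j < s ''k'' 0"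
  shows "den decode_prog s ''c'' (s ''u'' j) = s ''x'' 0 mod Suc d ^ Suc j div Suc d ^ j"
proof -
  let ?b = "digit_prog ;; Asg ''c'' (Read ''u'' (Minus (Var ''k'') (Plus (Var ''j'') (Const 1)))) (Var ''D'')"
  let ?s = "den (Set ''y'' (Var ''x'')) s"
  let ?x = "s ''x'' 0" and ?k = "s ''k'' 0"
  let ?I = "\<lambda>i t. t ''y'' 0 = ?x mod Suc d ^ (?k - i) \<and>
    (\<forall>j < ?k. ?k - i \<le> j \<longrightarrow> t ''c'' (s ''u'' j) = ?x mod Suc d ^ Suc j div Suc d ^ j)"
  have I: "?I (?s ''k'' 0) (den (For ''j'' ''k'' ?b) ?s)"
  proof (rule for_inv[where I = ?I])
    show "?I 0 (put ''j'' 0 ?s)" using x by simp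
    fix i t assume i: "i < ?s ''k'' 0" "t ''j'' 0 = i"
      and fr: "\<And>z. z \<notin> wr (For ''j'' ''k'' ?b) \<Longrightarrow> t z = ?s z" and I: "?I i t"
    define e where "e = ?k - Suc i"
    have e: "e < ?k" "?k - i = Suc e" using i by (auto simp: e_def)
    have Q: "t ''P'' (t ''k'' 0 - Suc (t ''j'' 0)) = Suc d ^ e" using P[of e] e i by (simp add: fr e_def)
    define r where "r = den digit_prog t"
    have "t ''y'' 0 < Suc d * Suc d ^ e" using I e by (simp del: mult_Suc)
    then have r: "r ''D'' 0 = (?x mod Suc d ^ Suc e) div Suc d ^ e" "r ''y'' 0 = (?x mod Suc d ^ Suc e) mod Suc d ^ e"
      using den_digit_prog[of t d "Suc d ^ e"] Q I e d unfolding r_def by (simp_all add: fr del: mult_Suc power_Suc)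
    have fr': "r z = t z" if "z \<notin> {''D'', ''l'', ''y''}" for z using that by (simp add: r_def den_frame)
    define w where "w = den ?b t"
    have w: "w ''y'' = r ''y''" "w ''c'' = (t ''c'')(s ''u'' e := r ''D'' 0)"
      unfolding w_def den.simps(2) r_def[symmetric] using i by (simp_all add: fr fr' e_def)
    have ne: "s ''u'' j \<noteq> s ''u'' e" if "j < ?k" "j \<noteq> e" for j
      using u that e by (auto simp: inj_on_def)
    have "?I (Suc i) w"
    proof (intro conjI allI impI)
      show "w ''y'' 0 = ?x mod Suc d ^ (?k - Suc i)"
        using w r by (simp add: e_def mod_mod_cancel le_imp_power_dvd del: power_Suc)
      fix j assume j: "j < ?k" "?k - Suc i \<le> j"
      show "w ''c'' (s ''u'' j) = ?x mod Suc d ^ Suc j div Suc d ^ j"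
      proof (cases "j = e")
        case True then show ?thesis using w r by simp
      next
        case False
        then have "?k - i \<le> j" using j e by (simp add: e_def)
        then show ?thesis using w ne[OF j(1) False] I j by simp
      qed
    qed
    then show "?I (Suc i) (put ''j'' (Suc i) (den ?b t))" unfolding w_def[symmetric] by simp
  qed
  have d: "?s ''k'' 0 = ?k" by simp
  have e: "den (For ''j'' ''k'' ?b) ?s = den decode_prog s" by (simp only: decode_prog_def den.simps(2))
  from I[unfolded d e] j show ?thesis by simp
qed

section \<open>Processing one guess: initial colours, phases, verification\<close>

context instance_lists
begin

text \<open>Only cells at vertices of \<open>G\<close> are reset, since the labels are unbounded;
  that the other cells are 0 has to be an assumption, which each round of the main loop
  restores.\<close>

lemma den_init_prog:
  assumes s: "loaded_mem s" and z: "\<And>v. v \<notin> verts G \<Longrightarrow> s ''C'' v = 0 \<and> s ''R'' v = 0"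
  shows "den init_prog s ''C'' v = (if v \<in> verts H then Suc v else 0)"
    "den init_prog s ''R'' v = of_bool (v \<in> verts H)"
proof -
  let ?b = "Asg ''C'' (Read ''v'' (Var ''j'')) (Const 0) ;; Asg ''R'' (Read ''v'' (Var ''j'')) (Const 0)"
  let ?c = "Asg ''C'' (Read ''w'' (Var ''j'')) (Plus (Read ''w'' (Var ''j'')) (Const 1)) ;;
       Asg ''R'' (Read ''w'' (Var ''j'')) (Const 1)"
  let ?I = "\<lambda>i t. \<forall>v. v \<notin> set (drop i VS) \<longrightarrow> t ''C'' v = 0 \<and> t ''R'' v = 0"
  have I: "?I (s ''n'' 0) (den (For ''j'' ''n'' ?b) s)"
  proof (rule for_inv[where I = ?I])
    show "?I 0 (put ''j'' 0 s)" using z VS by simp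
    fix i t assume i: "i < s ''n'' 0" "t ''j'' 0 = i"
      and fr: "\<And>z. z \<notin> wr (For ''j'' ''n'' ?b) \<Longrightarrow> t z = s z" and I: "?I i t"
    have v: "i < length VS" "t ''v'' i = VS ! i" using i s by (auto simp: loaded_def fr)
    have dr: "set (drop i VS) = insert (VS ! i) (set (drop (Suc i) VS))"
      using v by (simp flip: Cons_nth_drop_Suc)
    show "?I (Suc i) (put ''j'' (Suc i) (den ?b t))" using I i v unfolding dr by auto
  qed
  define t where "t = den (For ''j'' ''n'' ?b) s"
  have t0: "t ''C'' v = 0 \<and> t ''R'' v = 0" for v using I s unfolding t_def by (simp add: loaded_def del: den.simps)
  have fr0: "t z = s z" if "z \<notin> {''j'', ''C'', ''R''}" for z using that unfolding t_def by (intro den_frame) auto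
  let ?J = "\<lambda>i t. \<forall>v. t ''C'' v = (if v \<in> set (take i WS) then Suc v else 0) \<and> t ''R'' v = of_bool (v \<in> set (take i WS))"
  have J: "?J (t ''p'' 0) (den (For ''j'' ''p'' ?c) t)"
  proof (rule for_inv[where I = ?J])
    show "?J 0 (put ''j'' 0 t)" using t0 by simp
    fix i t' assume i: "i < t ''p'' 0" "t' ''j'' 0 = i"
      and fr: "\<And>z. z \<notin> wr (For ''j'' ''p'' ?c) \<Longrightarrow> t' z = t z" and I: "?J i t'"
    have v: "i < length WS" "t' ''w'' i = WS ! i" using i s by (auto simp: loaded_def fr fr0)
    have tk: "set (take (Suc i) WS) = insert (WS ! i) (set (take i WS))"
      using v by (simp add: take_Suc_conv_app_nth)
    show "?J (Suc i) (put ''j'' (Suc i) (den ?c t'))" using I i v unfolding tk by auto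
  qed
  have p: "t ''p'' 0 = length WS" using s by (simp add: fr0 loaded_def)
  have e: "den (For ''j'' ''p'' ?c) t = den init_prog s" by (simp only: init_prog_def t_def den.simps(2))
  from J[unfolded p e] show "den init_prog s ''C'' v = (if v \<in> verts H then Suc v else 0)"
    "den init_prog s ''R'' v = of_bool (v \<in> verts H)"
    using WS by simp_all
qed

text \<open>The inverse array \<open>z\<close> turns the question whether a neighbour occurs among
  the first \<open>i\<close> entries of the order into one comparison with \<open>i\<close>.\<close>

lemma den_candidates_prog:
  assumes s: "loaded_mem s" and X: "ordered X s" "set X = verts H" and i: "i < length X" "s ''i'' 0 = i"
  defines "s' \<equiv> den candidates_prog s"
  shows "s' ''y'' 0 = X ! i" "\<And>t. t < length (candidates X i) \<Longrightarrow> s' ''L'' t = candidates X i ! t"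
proof -
  let ?c = "Conj (Equal (Read ''f'' (Var ''l'')) (Var ''y''))
         (Neg (Less (Read ''z'' (Read ''g'' (Var ''l''))) (Var ''i'')))"
  let ?u = "Asg ''L'' (Var ''D'') (Read ''g'' (Var ''l'')) ;; Set ''D'' (Plus (Var ''D'') (Const 1))"
  define s0 where "s0 = den (Set ''y'' (Read ''o'' (Var ''i'')) ;; Set ''L'' (Var ''y'') ;; Set ''D'' (Const 1)) s"
  have s0: "s0 ''y'' 0 = X ! i" "s0 ''L'' 0 = X ! i" "s0 ''D'' 0 = 1"
    using X i by (simp_all add: s0_def ordered_def)
  have fr0: "s0 z = s z" if "z \<notin> {''y'', ''L'', ''D''}" for z using that unfolding s0_def by (intro den_frame) auto
  have e: "den (For ''l'' ''q'' (Cond ?c ?u)) s0 = s'"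
    by (simp only: s'_def s0_def candidates_prog_def den.simps(2))
  let ?P = "\<lambda>(a, b). a = X ! i \<and> b \<notin> set (take i X)"
  let ?cs = "\<lambda>l. X ! i # map snd (filter ?P (take l FS))"
  let ?I = "\<lambda>l t. t ''D'' 0 = length (?cs l) \<and> (\<forall>j < length (?cs l). t ''L'' j = ?cs l ! j)"
  have I: "?I (s0 ''q'' 0) (den (For ''l'' ''q'' (Cond ?c ?u)) s0)"
  proof (rule for_inv[where I = ?I])
    show "?I 0 (put ''l'' 0 s0)" using s0 by simp
    fix l t assume l: "l < s0 ''q'' 0" "t ''l'' 0 = l"
      and fr: "\<And>z. z \<notin> wr (For ''l'' ''q'' (Cond ?c ?u)) \<Longrightarrow> t z = s0 z" and I: "?I l t"
    have len: "l < length FS" using l s by (simp add: fr0 loaded_def)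
    obtain a b where ab: "FS ! l = (a, b)" by force
    have fg: "t ''f'' l = a" "t ''g'' l = b" using s len ab by (simp_all add: fr fr0 loaded_def)
    have "(a, b) \<in> set FS" using len ab nth_mem by metis
    then have "b \<in> set X" using FS_D X by blast
    then obtain j where j: "j < length X" "b = X ! j" by (metis in_set_conv_nth)
    have "t ''z'' b = j" using X j by (simp add: fr fr0 ordered_def)
    moreover have "b \<in> set (take i X) \<longleftrightarrow> j < i"
    proof
      assume "b \<in> set (take i X)"
      then obtain j' where "j' < i" "b = X ! j'" by (auto simp: in_set_conv_nth)
      moreover have "s ''z'' (X ! j') = j'" "s ''z'' (X ! j) = j" using X(1) j(1) i(1) \<open>j' < i\<close> by (auto simp: ordered_def)
      ultimately show "j < i" using j(2) by metis
    next
      assume "j < i" then show "b \<in> set (take i X)" using j by (auto simp: in_set_conv_nth)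
    qed
    ultimately have test: "bval ?c t \<longleftrightarrow> ?P (FS ! l)"
      using fg l i s0 ab by (auto simp: fr fr0)
    define r where "r = den (Cond ?c ?u) t"
    have "?I (Suc l) r"
    proof (cases "?P (FS ! l)")
      case False
      then have "r = t" unfolding r_def den.simps(3) test by simp
      moreover have "?cs (Suc l) = ?cs l" using len False by (simp add: take_Suc_conv_app_nth)
      ultimately show ?thesis using I by simp
    next
      case True
      then have r: "r ''D'' 0 = Suc (t ''D'' 0)" "r ''L'' = (t ''L'')(t ''D'' 0 := b)"
        unfolding r_def den.simps(3) test using fg l by simp_all
      define ls where "ls = ?cs l"
      have "?cs (Suc l) = ls @ [b]" using len True ab by (simp add: take_Suc_conv_app_nth ls_def)
      moreover have "t ''D'' 0 = length ls" "\<forall>j < length ls. t ''L'' j = ls ! j"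
        using I unfolding ls_def by blast+
      ultimately show ?thesis unfolding \<open>?cs (Suc l) = ls @ [b]\<close> using r by (simp add: nth_append less_Suc_eq)
    qed
    then show "?I (Suc l) (put ''l'' (Suc l) (den (Cond ?c ?u) t))" unfolding r_def[symmetric] by simp
  qed
  have q: "s0 ''q'' 0 = length FS" using s by (simp add: fr0 loaded_def)
  have "candidates X i = ?cs (length FS)" by (simp add: candidates_def later_def)
  then show "\<And>t. t < length (candidates X i) \<Longrightarrow> s' ''L'' t = candidates X i ! t"
    using I[unfolded q e] by simp
  have "s' ''y'' = s0 ''y''" unfolding e[symmetric] by (intro den_frame) auto
  then show "s' ''y'' 0 = X ! i" using s0 by simp
qed

text \<open>The first two facts hold for arbitrary digits and serve soundness and the restoration of
  zero cells; only the third is about the run that follows \<open>\<phi>\<close>.\<close>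

lemma den_phase_prog:
  assumes s: "loaded_mem s" and X: "ordered X s" "elimination_order X d" and i: "i < length X" "s ''i'' 0 = i"
  defines "s' \<equiv> den phase_prog s"
  shows "extends (s ''C'') (s' ''C'')" "v \<notin> verts G \<Longrightarrow> s' ''C'' v = s ''C'' v"
    "contraction_map G H \<phi> \<Longrightarrow> consistent X \<phi> i (s ''C'') \<Longrightarrow>
       (\<And>v. v \<in> verts G - verts H \<Longrightarrow> s ''c'' v = guess X \<phi> v) \<Longrightarrow> consistent X \<phi> (Suc i) (s' ''C'')"
proof -
  have setX: "set X = verts H" using X WS by (simp add: elimination_order_def)
  define s1 where "s1 = den candidates_prog s"
  note c = den_candidates_prog[OF s X(1) setX i, folded s1_def]
  have fr: "s1 z = s z" if "z \<notin> {''y'', ''L'', ''D'', ''l''}" for z using that by (simp add: s1_def den_frame)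
  let ?P = "\<lambda>x (a::nat) (b::nat). x = Suc (X ! i)" and ?g = "\<lambda>b. Suc (s1 ''L'' (s ''c'' b))"
  have "s' ''C'' = (fold (spread ?P ?g) ES ^^ s1 ''n'' 0) (s1 ''C'')"
    unfolding s'_def phase_prog_def den.simps(2) s1_def[symmetric]
    by (rule den_spread_prog) (use s c(1) in \<open>auto simp: fr loaded_def\<close>)
  then have C: "s' ''C'' = (fold (spread ?P ?g) ES ^^ length VS) (s ''C'')"
    using s by (simp add: fr loaded_def)
  show "extends (s ''C'') (s' ''C'')" unfolding C by (rule extends_funpow_spread)
  show "s' ''C'' v = s ''C'' v" if v: "v \<notin> verts G"
    unfolding C by (rule funpow_spread_induct[where Q = "\<lambda>r. r v = s ''C'' v"]) (use v ES_D in auto)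
  show "consistent X \<phi> (Suc i) (s' ''C'')" if "contraction_map G H \<phi>" "consistent X \<phi> i (s ''C'')"
    "\<And>v. v \<in> verts G - verts H \<Longrightarrow> s ''c'' v = guess X \<phi> v"
    unfolding C using that c(2) by (intro consistent_phase[OF that(1) X(2) that(2) i(1)]) auto
qed

lemma den_reach_prog:
  assumes s: "loaded_mem s"
  shows "den reach_prog s ''R'' = reach (s ''C'') (s ''R'')"
proof -
  have "den reach_prog s ''R'' = (fold (spread (\<lambda>x a b. x = 1 \<and> s ''C'' a = s ''C'' b) (\<lambda>_. 1)) ES ^^ s ''n'' 0) (s ''R'')"
    unfolding reach_prog_def by (rule den_spread_prog) (use s in \<open>auto simp: loaded_def\<close>)
  then show ?thesis using s by (simp add: reach_def loaded_def)
qed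

lemma den_check_prog:
  assumes s: "loaded_mem s"
  shows "den check_prog s ''K'' 0 = of_bool (accepts (s ''C'') (s ''R''))"
proof -
  define C where "C = s ''C''"
  define R where "R = s ''R''"
  define s1 where "s1 = den (Set ''K'' (Const 1)) s"
  define s2 where "s2 = den all_reached_prog s1"
  define s3 where "s3 = den edges_into_prog s2"
  define m where "m = (\<lambda>(a, b) (x, y). C a = Suc x \<and> C b = Suc y)"
  have fr: "s1 z = s z" "s2 z = s z" "s3 z = s z" if "z \<notin> {''j'', ''F'', ''l'', ''K''}" for z
    using that by (simp_all add: s1_def s2_def s3_def den_frame)
  have l: "s ''n'' 0 = length VS" "s ''m'' 0 = length ES" "s ''q'' 0 = length FS"
    using s by (simp_all add: loaded_def)
  have K1: "s1 ''K'' 0 = 1" by (simp add: s1_def)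
  have test: "bval (match_test e f) t \<longleftrightarrow> m (ES ! i) (FS ! j)"
    if "t e 0 = i" "t f 0 = j" "i < length ES" "j < length FS"
      "\<And>z. z \<notin> {''j'', ''F'', ''l'', ''K''} \<Longrightarrow> t z = s z" for e f t i j
    using that s by (auto simp: match_test_def loaded_def C_def m_def split: prod.splits)
  have "s2 ''K'' 0 = (if \<forall>i < s1 ''n'' 0. R (VS ! i) \<noteq> 0 then s1 ''K'' 0 else 0)"
    unfolding s2_def all_reached_prog_def
    by (rule den_all_loop) (use s in \<open>auto simp: fr loaded_def R_def\<close>)
  then have K2: "s2 ''K'' 0 = of_bool (\<forall>v \<in> set VS. R v \<noteq> 0)"
    using K1 l by (simp add: fr all_set_conv_all_nth)
  have "s3 ''K'' 0 = (if \<forall>i < s2 ''m'' 0. C (fst (ES ! i)) \<noteq> C (snd (ES ! i)) \<longrightarrow> (\<exists>j < length FS. m (ES ! i) (FS ! j))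
      then s2 ''K'' 0 else 0)"
    unfolding s3_def edges_into_prog_def
  proof (rule den_all_loop)
    let ?t = "Neg (Equal (Read ''C'' (Read ''a'' (Var ''j''))) (Read ''C'' (Read ''b'' (Var ''j''))))"
    let ?f = "For ''l'' ''q'' (Cond (match_test ''j'' ''l'') (Set ''F'' (Const 1)))"
    let ?e = "Cond (Equal (Var ''F'') (Const 0)) (Set ''K'' (Const 0))"
    let ?b = "Cond ?t (Set ''F'' (Const 0) ;; ?f ;; ?e)"
    fix i t assume i: "i < s2 ''m'' 0" "t ''j'' 0 = i"
      and fr': "\<And>z. z \<notin> wr (For ''j'' ''m'' ?b) \<Longrightarrow> t z = s2 z"
    have frt: "t z = s z" if "z \<notin> {''j'', ''F'', ''l'', ''K''}" for z using that by (simp add: fr' fr)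
    have len: "i < length ES" using i l by (simp add: fr)
    have ab: "bval ?t t \<longleftrightarrow> C (fst (ES ! i)) \<noteq> C (snd (ES ! i))"
      using s len i by (simp add: frt loaded_def C_def)
    define t1 where "t1 = den (Set ''F'' (Const 0)) t"
    define t2 where "t2 = den ?f t1"
    have fr1: "t1 z = t z" if "z \<noteq> ''F''" for z using that by (simp add: t1_def)
    have "t2 ''F'' 0 = (if \<exists>j < t1 ''q'' 0. m (ES ! i) (FS ! j) then 1 else t1 ''F'' 0)"
      unfolding t2_def
    proof (rule den_flag_loop)
      fix j t' assume "j < t1 ''q'' 0" "t' ''l'' 0 = j" "\<And>z. z \<notin> {''l'', ''F''} \<Longrightarrow> t' z = t1 z"
      then show "bval (match_test ''j'' ''l'') t' \<longleftrightarrow> m (ES ! i) (FS ! j)"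
        using i len l by (intro test) (auto simp: fr1 frt)
    qed simp
    then have F: "t2 ''F'' 0 = of_bool (\<exists>j < length FS. m (ES ! i) (FS ! j))"
      using l by (simp add: fr1 frt t1_def)
    have K: "t2 ''K'' = t ''K''" unfolding t2_def by (subst den_frame) (simp_all add: fr1)
    have "den ?b t = (if bval ?t t then den ?e t2 else t)"
      by (simp only: den.simps(2,3) t1_def t2_def)
    then show "den ?b t ''K'' 0 = (if C (fst (ES ! i)) \<noteq> C (snd (ES ! i)) \<longrightarrow> (\<exists>j < length FS. m (ES ! i) (FS ! j))
       then t ''K'' 0 else 0)"
      unfolding ab using F K by (auto simp del: den.simps(2))
  qed simp
  then have K3: "s3 ''K'' 0 = of_bool ((\<forall>v \<in> set VS. R v \<noteq> 0) \<and>
      (\<forall>e \<in> set ES. C (fst e) \<noteq> C (snd e) \<longrightarrow> (\<exists>f \<in> set FS. m e f)))"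
    using K2 l by (simp add: fr all_set_conv_all_nth ex_set_conv_ex_nth)
  have "den edges_onto_prog s3 ''K'' 0 = (if \<forall>j < s3 ''q'' 0. \<exists>i < length ES. m (ES ! i) (FS ! j) then s3 ''K'' 0 else 0)"
    unfolding edges_onto_prog_def
  proof (rule den_all_loop)
    let ?f = "For ''l'' ''m'' (Cond (match_test ''l'' ''j'') (Set ''F'' (Const 1)))"
    let ?e = "Cond (Equal (Var ''F'') (Const 0)) (Set ''K'' (Const 0))"
    let ?b = "Set ''F'' (Const 0) ;; ?f ;; ?e"
    fix j t assume j: "j < s3 ''q'' 0" "t ''j'' 0 = j"
      and fr': "\<And>z. z \<notin> wr (For ''j'' ''q'' ?b) \<Longrightarrow> t z = s3 z"
    have frt: "t z = s z" if "z \<notin> {''j'', ''F'', ''l'', ''K''}" for z using that by (simp add: fr' fr)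
    have len: "j < length FS" using j l by (simp add: fr)
    define t1 where "t1 = den (Set ''F'' (Const 0)) t"
    define t2 where "t2 = den ?f t1"
    have fr1: "t1 z = t z" if "z \<noteq> ''F''" for z using that by (simp add: t1_def)
    have "t2 ''F'' 0 = (if \<exists>i < t1 ''m'' 0. m (ES ! i) (FS ! j) then 1 else t1 ''F'' 0)"
      unfolding t2_def
    proof (rule den_flag_loop)
      fix i t' assume "i < t1 ''m'' 0" "t' ''l'' 0 = i" "\<And>z. z \<notin> {''l'', ''F''} \<Longrightarrow> t' z = t1 z"
      then show "bval (match_test ''l'' ''j'') t' \<longleftrightarrow> m (ES ! i) (FS ! j)"
        using j len l by (intro test) (auto simp: fr1 frt)
    qed simp
    then have F: "t2 ''F'' 0 = of_bool (\<exists>i < length ES. m (ES ! i) (FS ! j))"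
      using l by (simp add: fr1 frt t1_def)
    have K: "t2 ''K'' = t ''K''" unfolding t2_def by (subst den_frame) (simp_all add: fr1)
    have "den ?b t = den ?e t2"
      by (simp only: den.simps(2) t1_def t2_def)
    then show "den ?b t ''K'' 0 = (if \<exists>i < length ES. m (ES ! i) (FS ! j) then t ''K'' 0 else 0)"
      using F K by (auto simp del: den.simps(2))
  qed simp
  then have "den edges_onto_prog s3 ''K'' 0 = of_bool ((\<forall>v \<in> set VS. R v \<noteq> 0) \<and>
      (\<forall>e \<in> set ES. C (fst e) \<noteq> C (snd e) \<longrightarrow> (\<exists>f \<in> set FS. m e f)) \<and> (\<forall>f \<in> set FS. \<exists>e \<in> set ES. m e f))"
    using K3 l by (simp add: fr all_set_conv_all_nth ex_set_conv_ex_nth)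
  moreover have "den edges_onto_prog s3 = den check_prog s"
    by (simp only: check_prog_def s1_def s2_def s3_def den.simps(2))
  ultimately show ?thesis
    by (simp add: accepts_def C_def R_def m_def case_prod_beta)
qed

end

section \<open>Powers of the base and the enumeration of all guesses\<close>

definition main_prog :: loop where
  "main_prog = For ''x'' ''N'' body_prog"

definition power_prog :: loop where
  "power_prog = For ''j'' ''k'' (Set ''y'' (Const 0) ;;
     For ''l'' ''E'' (Set ''y'' (Plus (Var ''y'') (Read ''P'' (Var ''j'')))) ;;
     Asg ''P'' (Plus (Var ''j'') (Const 1)) (Var ''y''))"

lemma main_simps [simp]:
  "wr main_prog = insert ''x'' (wr body_prog)" "bds main_prog = insert ''N'' (bds body_prog)" "wf_loop main_prog"
  "wr power_prog = {''j'', ''y'', ''l'', ''P''}" "bds power_prog = {''k'', ''E''}" "wf_loop power_prog"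
  by (auto simp: main_prog_def power_prog_def)

lemma den_power_prog:
  assumes P: "s ''P'' 0 = 1"
  shows "j \<le> s ''k'' 0 \<Longrightarrow> den power_prog s ''P'' j = s ''E'' 0 ^ j"
proof -
  let ?f = "Set ''y'' (Plus (Var ''y'') (Read ''P'' (Var ''j'')))"
  let ?a = "Asg ''P'' (Plus (Var ''j'') (Const 1)) (Var ''y'')"
  let ?b = "Set ''y'' (Const 0) ;; For ''l'' ''E'' ?f ;; ?a"
  let ?I = "\<lambda>i t. \<forall>j \<le> i. t ''P'' j = s ''E'' 0 ^ j"
  have I: "?I (s ''k'' 0) (den power_prog s)"
    unfolding power_prog_def
  proof (rule for_inv[where I = ?I])
    show "?I 0 (put ''j'' 0 s)" using P by simp
    fix i t assume i: "t ''j'' 0 = i" and fr: "\<And>z. z \<notin> wr (For ''j'' ''k'' ?b) \<Longrightarrow> t z = s z" and I: "?I i t"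
    define t1 where "t1 = den (Set ''y'' (Const 0)) t"
    have t1: "t1 ''y'' 0 = 0" "\<And>z. z \<noteq> ''y'' \<Longrightarrow> t1 z = t z" by (simp_all add: t1_def)
    define t2 where "t2 = den (For ''l'' ''E'' ?f) t1"
    let ?J = "\<lambda>l t'. t' ''y'' 0 = l * s ''E'' 0 ^ i"
    have J: "?J (t1 ''E'' 0) t2"
      unfolding t2_def
    proof (rule for_inv[where I = ?J])
      show "?J 0 (put ''l'' 0 t1)" using t1 by simp
      fix l t' assume fr': "\<And>z. z \<notin> wr (For ''l'' ''E'' ?f) \<Longrightarrow> t' z = t1 z" and J: "?J l t'"
      show "?J (Suc l) (put ''l'' (Suc l) (den ?f t'))" using I J i by (simp add: fr' t1)
    qed
    have t2: "t2 z = t1 z" if "z \<notin> {''y'', ''l''}" for z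
      using that unfolding t2_def by (intro den_frame) auto
    have e: "den ?b t = den ?a t2" by (simp only: t1_def t2_def den.simps(2))
    have E: "t1 ''E'' 0 = s ''E'' 0" by (simp add: t1 fr)
    have "den ?b t ''P'' = (t ''P'')(Suc i := s ''E'' 0 ^ Suc i)"
      unfolding e using J i by (simp add: t2 t1 E fr)
    then show "?I (Suc i) (put ''j'' (Suc i) (den ?b t))" using I by (auto simp: le_Suc_eq simp del: den.simps)
  qed
  then show "j \<le> s ''k'' 0 \<Longrightarrow> den power_prog s ''P'' j = s ''E'' 0 ^ j" by blast
qed

context instance_lists
begin

abbreviation "others \<equiv> filter (\<lambda>v. v \<notin> set WS) VS"

text \<open>With its counterpart for the colours, this keeps the cells outside \<open>G\<close> at 0
  from one guess to the next.\<close>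

lemma reach_outside: "v \<notin> verts G \<Longrightarrow> reach col r v = r v"
  unfolding reach_def by (rule funpow_spread_induct[where Q = "\<lambda>r'. r' v = r v"]) (use ES_D in auto)

lemma consistent_0: "(\<And>v. col v = (if v \<in> verts H then Suc v else 0)) \<Longrightarrow> contraction_map G H \<phi> \<Longrightarrow> consistent X \<phi> 0 col"
  by (auto simp: consistent_def contraction_map_def)

lemma den_phases:
  assumes s: "loaded_mem s" and X: "ordered X s" "elimination_order X d"
  defines "s' \<equiv> den (For ''i'' ''p'' phase_prog) s"
  shows "extends (s ''C'') (s' ''C'')" "v \<notin> verts G \<Longrightarrow> s' ''C'' v = s ''C'' v"
    "contraction_map G H \<phi> \<Longrightarrow> consistent X \<phi> 0 (s ''C'') \<Longrightarrow>
       (\<And>v. v \<in> verts G - verts H \<Longrightarrow> s ''c'' v = guess X \<phi> v) \<Longrightarrow> consistent X \<phi> (length X) (s' ''C'')"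
proof -
  have len: "length X = length WS" using X WS by (metis elimination_order_def distinct_card)
  let ?I = "\<lambda>i t. extends (s ''C'') (t ''C'') \<and> (\<forall>v. v \<notin> verts G \<longrightarrow> t ''C'' v = s ''C'' v) \<and>
    (contraction_map G H \<phi> \<longrightarrow> consistent X \<phi> 0 (s ''C'') \<longrightarrow>
      (\<forall>v \<in> verts G - verts H. s ''c'' v = guess X \<phi> v) \<longrightarrow> consistent X \<phi> i (t ''C''))"
  have I: "?I (s ''p'' 0) s'"
    unfolding s'_def
  proof (rule for_inv[where I = ?I])
    show "?I 0 (put ''i'' 0 s)" by (simp add: extends_def)
    fix i t assume i: "i < s ''p'' 0" "t ''i'' 0 = i"
      and fr: "\<And>z. z \<notin> wr (For ''i'' ''p'' phase_prog) \<Longrightarrow> t z = s z" and I: "?I i t"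
    have l: "loaded_mem t" using s by (subst loaded_cong[of _ s]) (auto simp: fr)
    have o: "ordered X t" using X by (simp add: fr ordered_def)
    have iX: "i < length X" using i s len by (simp add: loaded_def)
    note ph = den_phase_prog[OF l o X(2) iX i(2)]
    define w where "w = den phase_prog t"
    have "?I (Suc i) w"
      using I ph[folded w_def] fr[of "''c''"] unfolding extends_def by (auto simp del: den.simps)
    then show "?I (Suc i) (put ''i'' (Suc i) (den phase_prog t))" unfolding w_def by simp
  qed
  have p: "s ''p'' 0 = length X" using s len by (simp add: loaded_def)
  from I[unfolded p] show "extends (s ''C'') (s' ''C'')" "v \<notin> verts G \<Longrightarrow> s' ''C'' v = s ''C'' v"
    "contraction_map G H \<phi> \<Longrightarrow> consistent X \<phi> 0 (s ''C'') \<Longrightarrow>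
       (\<And>v. v \<in> verts G - verts H \<Longrightarrow> s ''c'' v = guess X \<phi> v) \<Longrightarrow> consistent X \<phi> (length X) (s' ''C'')"
    by blast+
qed

text \<open>Acceptance is described by two one-sided implications: it always yields a partition, and
  it is guaranteed for the number whose digits are those of some \<open>\<phi>\<close>.\<close>

lemma den_body_prog:
  assumes s: "loaded_mem s" and X: "ordered X s" "elimination_order X d" and d: "s ''d'' 0 = d"
    and P: "\<And>j. j < s ''k'' 0 \<Longrightarrow> s ''P'' j = Suc d ^ j" and x: "s ''x'' 0 < Suc d ^ s ''k'' 0"
    and z: "\<And>v. v \<notin> verts G \<Longrightarrow> s ''C'' v = 0 \<and> s ''R'' v = 0"
  defines "s' \<equiv> den body_prog s"
  shows "v \<notin> verts G \<Longrightarrow> s' ''C'' v = 0 \<and> s' ''R'' v = 0"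
    "\<exists>acc. (acc \<longrightarrow> (\<exists>\<phi>. contraction_map G H \<phi>)) \<and>
       (\<forall>\<phi>. contraction_map G H \<phi> \<longrightarrow>
         (\<forall>j < s ''k'' 0. s ''x'' 0 mod Suc d ^ Suc j div Suc d ^ j = guess X \<phi> (others ! j)) \<longrightarrow> acc) \<and>
       s' ''out'' 0 = (if acc then 1 else s ''out'' 0)"
proof -
  define s1 where "s1 = den decode_prog s"
  define s2 where "s2 = den init_prog s1"
  define s3 where "s3 = den (For ''i'' ''p'' phase_prog) s2"
  define s4 where "s4 = den reach_prog s3"
  define s5 where "s5 = den check_prog s4"
  define e where "e = Cond (Equal (Var ''K'') (Const 1)) (Set ''out'' (Const 1))"
  have s': "s' = den e s5"
    by (simp only: s'_def body_prog_def s1_def s2_def s3_def s4_def s5_def e_def den.simps(2))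
  have fr1: "s1 z = s z" if "z \<notin> {''y'', ''j'', ''D'', ''l'', ''c''}" for z
    using that by (simp add: s1_def den_frame)
  have fr2: "s2 z = s1 z" if "z \<notin> {''j'', ''C'', ''R''}" for z using that by (simp add: s2_def den_frame)
  have fr3: "s3 z = s2 z" if "z \<notin> {''i'', ''y'', ''L'', ''D'', ''l'', ''j'', ''C''}" for z
    using that unfolding s3_def by (intro den_frame) auto
  have fr4: "s4 z = s3 z" if "z \<notin> {''j'', ''l'', ''R''}" for z using that by (simp add: s4_def den_frame)
  have fr5: "s5 z = s4 z" if "z \<notin> {''j'', ''F'', ''l'', ''K''}" for z using that by (simp add: s5_def den_frame)
  have l1: "loaded_mem s1" using s by (subst loaded_cong[of _ s]) (auto simp: fr1)
  have l2: "loaded_mem s2" using l1 by (subst loaded_cong[of _ s1]) (auto simp: fr2)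
  have l3: "loaded_mem s3" using l2 by (subst loaded_cong[of _ s2]) (auto simp: fr3)
  have l4: "loaded_mem s4" using l3 by (subst loaded_cong[of _ s3]) (auto simp: fr4)
  have o2: "ordered X s2" using X by (simp add: ordered_def fr1 fr2)
  have z1: "v \<notin> verts G \<Longrightarrow> s1 ''C'' v = 0 \<and> s1 ''R'' v = 0" for v using z by (simp add: fr1)
  have C2: "s2 ''C'' v = (if v \<in> verts H then Suc v else 0)" "s2 ''R'' v = of_bool (v \<in> verts H)" for v
    unfolding s2_def by (rule den_init_prog[OF l1 z1]; simp)+
  note ph = den_phases[OF l2 o2 X(2), folded s3_def]
  have C4: "s4 ''C'' = s3 ''C''" by (simp add: fr4)
  have R4: "s4 ''R'' = reach (s3 ''C'') (s2 ''R'')"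
    unfolding s4_def den_reach_prog[OF l3] by (simp add: fr3)
  define acc where "acc = accepts (s3 ''C'') (reach (s3 ''C'') (s2 ''R''))"
  have K: "s5 ''K'' 0 = of_bool acc"
    unfolding s5_def den_check_prog[OF l4] C4 R4 acc_def ..
  have "s5 ''out'' = s ''out''" by (simp add: fr1 fr2 fr3 fr4 fr5)
  then have out: "s' ''out'' 0 = (if acc then 1 else s ''out'' 0)" using K by (simp add: s' e_def)
  have e': "s' z = s5 z" if "z \<noteq> ''out''" for z using that by (simp add: s' e_def)
  show "s' ''C'' v = 0 \<and> s' ''R'' v = 0" if v: "v \<notin> verts G"
    using v ph(2)[OF v] C2[of v] reach_outside[OF v] sub by (auto simp: e' fr5 C4 R4)
  have col: "s3 ''C'' h = Suc h" if "h \<in> verts H" for h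
    using ph(1) C2(1)[of h] that by (simp add: extends_def)
  have sound: "\<exists>\<phi>. contraction_map G H \<phi>" if acc
    using accepts_sound[OF col C2(2)] that unfolding acc_def by blast
  have complete: acc if \<phi>: "contraction_map G H \<phi>"
    and g: "\<forall>j < s ''k'' 0. s ''x'' 0 mod Suc d ^ Suc j div Suc d ^ j = guess X \<phi> (others ! j)" for \<phi>
  proof -
    have u: "s ''k'' 0 = length others" "\<And>j. j < length others \<Longrightarrow> s ''u'' j = others ! j"
      using s by (simp_all add: loaded_def)
    have dist: "distinct others" using VS by simp
    have inj: "inj_on (s ''u'') {..<s ''k'' 0}"
      using dist u by (auto simp: inj_on_def nth_eq_iff_index_eq)
    have c: "s2 ''c'' v = guess X \<phi> v" if v: "v \<in> verts G - verts H" for v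
    proof -
      have "v \<in> set others" using v VS WS by simp
      then obtain j where j: "j < length others" "v = others ! j" by (metis in_set_conv_nth)
      have "s1 ''c'' (s ''u'' j) = s ''x'' 0 mod Suc d ^ Suc j div Suc d ^ j"
        unfolding s1_def using j u by (intro den_decode_prog[OF d P x inj]) auto
      then show ?thesis using g j u by (simp add: fr2 del: power_Suc)
    qed
    have con: "consistent X \<phi> (length X) (s3 ''C'')"
      by (rule ph(3)[OF \<phi> consistent_0[OF C2(1) \<phi>] c])
    show acc unfolding acc_def
      by (rule accepts_complete[OF \<phi> consistent_final[OF \<phi> X(2) con] C2(2)])
  qed
  show "\<exists>acc. (acc \<longrightarrow> (\<exists>\<phi>. contraction_map G H \<phi>)) \<and>
       (\<forall>\<phi>. contraction_map G H \<phi> \<longrightarrow>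
         (\<forall>j < s ''k'' 0. s ''x'' 0 mod Suc d ^ Suc j div Suc d ^ j = guess X \<phi> (others ! j)) \<longrightarrow> acc) \<and>
       s' ''out'' 0 = (if acc then 1 else s ''out'' 0)"
    using sound complete out by blast
qed

lemma den_main_prog:
  assumes s: "loaded_mem s" and X: "ordered X s" "elimination_order X d" and d: "s ''d'' 0 = d"
    and P: "\<And>j. j < s ''k'' 0 \<Longrightarrow> s ''P'' j = Suc d ^ j" and N: "s ''N'' 0 = Suc d ^ s ''k'' 0"
    and z: "\<And>v. v \<notin> verts G \<Longrightarrow> s ''C'' v = 0 \<and> s ''R'' v = 0" and out: "s ''out'' 0 = 0"
  shows "den main_prog s ''out'' 0 = of_bool (\<exists>\<phi>. contraction_map G H \<phi>)"
proof -
  let ?g = "\<lambda>\<phi> x. \<forall>j < s ''k'' 0. x mod Suc d ^ Suc j div Suc d ^ j = guess X \<phi> (others ! j)"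
  let ?I = "\<lambda>i t. (\<forall>v. v \<notin> verts G \<longrightarrow> t ''C'' v = 0 \<and> t ''R'' v = 0) \<and> t ''out'' 0 \<in> {0, 1} \<and>
     (t ''out'' 0 = 1 \<longrightarrow> (\<exists>\<phi>. contraction_map G H \<phi>)) \<and>
     (\<forall>\<phi> x. contraction_map G H \<phi> \<longrightarrow> x < i \<longrightarrow> ?g \<phi> x \<longrightarrow> t ''out'' 0 = 1)"
  have I: "?I (s ''N'' 0) (den main_prog s)"
    unfolding main_prog_def
  proof (rule for_inv[where I = ?I])
    show "?I 0 (put ''x'' 0 s)" using z out by simp
    fix i t assume i: "i < s ''N'' 0" "t ''x'' 0 = i"
      and fr: "\<And>z. z \<notin> wr (For ''x'' ''N'' body_prog) \<Longrightarrow> t z = s z" and I: "?I i t"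
    have l: "loaded_mem t" using s by (subst loaded_cong[of _ s]) (auto simp: fr)
    have o: "ordered X t" using X by (simp add: fr ordered_def)
    have k: "t ''k'' 0 = s ''k'' 0" by (simp add: fr)
    define w where "w = den body_prog t"
    note b = den_body_prog[OF l o X(2), folded w_def, unfolded k i(2)]
    have w: "v \<notin> verts G \<Longrightarrow> w ''C'' v = 0 \<and> w ''R'' v = 0" for v
      using d P i N I by (intro b(1)) (auto simp: fr)
    obtain acc where acc: "acc \<longrightarrow> (\<exists>\<phi>. contraction_map G H \<phi>)"
      "\<And>\<phi>. contraction_map G H \<phi> \<Longrightarrow> ?g \<phi> i \<Longrightarrow> acc" "w ''out'' 0 = (if acc then 1 else t ''out'' 0)"
    proof -
      have "\<exists>acc. (acc \<longrightarrow> (\<exists>\<phi>. contraction_map G H \<phi>)) \<and>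
       (\<forall>\<phi>. contraction_map G H \<phi> \<longrightarrow> ?g \<phi> i \<longrightarrow> acc) \<and> w ''out'' 0 = (if acc then 1 else t ''out'' 0)"
        by (rule b(2)) (use d P i N I in \<open>auto simp: fr\<close>)
      then show ?thesis using that by blast
    qed
    have "?I (Suc i) w" using I w acc by (auto simp: less_Suc_eq simp del: power_Suc)
    then show "?I (Suc i) (put ''x'' (Suc i) (den body_prog t))" unfolding w_def by simp
  qed
  show ?thesis
  proof (cases "\<exists>\<phi>. contraction_map G H \<phi>")
    case True
    then obtain \<phi> where \<phi>: "contraction_map G H \<phi>" by blast
    \<comment> \<open>Every digit of the run for \<open>\<phi>\<close> is at most \<open>d\<close>,
      so a number below \<open>N\<close> encodes all of them.\<close>
    obtain x where "x < Suc d ^ s ''k'' 0" "?g \<phi> x"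
      using digits_surj[of "s ''k'' 0" "\<lambda>j. guess X \<phi> (others ! j)" d] guess_le[OF X(2)] by blast
    then show ?thesis using I \<phi> N True by auto
  next
    case False
    then show ?thesis using I by auto
  qed
qed

end

lemma tb_cong: "(\<And>y. y \<in> bds p \<Longrightarrow> L y = L' y) \<Longrightarrow> tb p L = tb p L'"
  by (induction p) auto

text \<open>With one common bound \<open>M\<close> for all limits, a loop multiplies by
  \<open>M\<close> and the nesting depth is static, so the bound is a polynomial in
  \<open>M\<close>.\<close>

lemma tb_poly: "\<exists>q. \<forall>M. tb p (\<lambda>_. M) = poly q M"
proof (induction p)
  case (Asg x a b)
  show ?case by (rule exI[of _ "[:1 + acost a + acost b:]"]) simp
next
  case (Sq p1 p2)
  then obtain q1 q2 where "\<forall>M. tb p1 (\<lambda>_. M) = poly q1 M" "\<forall>M. tb p2 (\<lambda>_. M) = poly q2 M" by blast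
  then show ?case by (intro exI[of _ "q1 + q2"]) simp
next
  case (Cond b p)
  then obtain q where "\<forall>M. tb p (\<lambda>_. M) = poly q M" by blast
  then show ?case by (intro exI[of _ "[:2 + bcost b:] + q"]) simp
next
  case (For x y p)
  then obtain q where "\<forall>M. tb p (\<lambda>_. M) = poly q M" by blast
  then show ?case by (intro exI[of _ "[:9:] + [:0, 1:] * ([:12:] + q)"]) (simp add: algebra_simps)
qed

section \<open>Reading the input and running time\<close>

definition pairs :: "(nat \<times> nat) list \<Rightarrow> nat list" where
  "pairs es = concat (map (\<lambda>(u, v). [u, v]) es)"

lemma length_pairs: "length (pairs es) = length es + length es"
  by (induction es) (auto simp: pairs_def)

lemma nth_pairs:
  "i < length es \<Longrightarrow> pairs es ! (i + i) = fst (es ! i)"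
  "i < length es \<Longrightarrow> pairs es ! Suc (i + i) = snd (es ! i)"
proof (induction es arbitrary: i)
  case (Cons e es)
  case 1
  then show ?case using Cons.IH(1) by (cases i) (auto simp: pairs_def split: prod.split)
next
  case (Cons e es)
  case 2
  then show ?case using Cons.IH(2) by (cases i) (auto simp: pairs_def split: prod.split)
qed simp_all

definition sym_edges :: "(nat \<times> nat) list \<Rightarrow> (nat \<times> nat) list" where
  "sym_edges es = es @ map prod.swap es"

definition graph_word :: "nat list \<Rightarrow> (nat \<times> nat) list \<Rightarrow> nat list" where
  "graph_word vs es = length vs # length es # vs @ pairs es"

text \<open>Addresses: \<open>t\<close> and \<open>T\<close> are where the edge lists of
  \<open>G\<close> and \<open>H\<close> begin, \<open>s\<close> is where the word of
  \<open>H\<close> begins and \<open>S\<close> its vertex list. \<open>h\<close> and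
  \<open>r\<close> are the edge counts as written in the input, half of \<open>m\<close> and
  \<open>q\<close>.\<close>

definition layout_prog :: loop where
  "layout_prog = Set ''n'' (Read ''in'' (Const 0)) ;; Set ''h'' (Read ''in'' (Const 1)) ;;
     Set ''m'' (Plus (Var ''h'') (Var ''h'')) ;; Set ''t'' (Plus (Const 2) (Var ''n'')) ;;
     Set ''s'' (Plus (Var ''t'') (Var ''m'')) ;; Set ''p'' (Read ''in'' (Var ''s'')) ;;
     Set ''r'' (Read ''in'' (Plus (Var ''s'') (Const 1))) ;; Set ''q'' (Plus (Var ''r'') (Var ''r'')) ;;
     Set ''S'' (Plus (Var ''s'') (Const 2)) ;; Set ''T'' (Plus (Var ''S'') (Var ''p''))"

definition edges_prog :: "string \<Rightarrow> string \<Rightarrow> string \<Rightarrow> string \<Rightarrow> loop" where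
  "edges_prog n A B t = For ''i'' n
     (Asg A (Var ''i'') (Read ''in'' (Plus (Var t) (Plus (Var ''i'') (Var ''i'')))) ;;
      Asg B (Var ''i'') (Read ''in'' (Plus (Var t) (Plus (Const 1) (Plus (Var ''i'') (Var ''i''))))) ;;
      Asg A (Plus (Var n) (Var ''i'')) (Read B (Var ''i'')) ;;
      Asg B (Plus (Var n) (Var ''i'')) (Read A (Var ''i'')))"

definition vertices_prog :: loop where
  "vertices_prog = For ''i'' ''n'' (Asg ''v'' (Var ''i'') (Read ''in'' (Plus (Const 2) (Var ''i'')))) ;;
     For ''i'' ''p'' (Asg ''w'' (Var ''i'') (Read ''in'' (Plus (Var ''S'') (Var ''i''))) ;;
       Asg ''H'' (Read ''w'' (Var ''i'')) (Const 1)) ;;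
     For ''i'' ''n'' (Cond (Equal (Read ''H'' (Read ''v'' (Var ''i''))) (Const 0))
       (Asg ''u'' (Var ''k'') (Read ''v'' (Var ''i'')) ;; Set ''k'' (Plus (Var ''k'') (Const 1))))"

definition load_prog :: loop where
  "load_prog = vertices_prog ;; edges_prog ''h'' ''a'' ''b'' ''t'' ;; edges_prog ''r'' ''f'' ''g'' ''T''"

lemma load_simps [simp]:
  "wr layout_prog = {''n'', ''h'', ''m'', ''t'', ''s'', ''p'', ''r'', ''q'', ''S'', ''T''}"
  "bds layout_prog = {}" "wf_loop layout_prog"
  "wr (edges_prog n A B t) = {''i'', A, B}" "bds (edges_prog n A B t) = {n}"
  "''i'' \<noteq> A \<Longrightarrow> ''i'' \<noteq> B \<Longrightarrow> wf_loop (edges_prog n A B t)"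
  "wr vertices_prog = {''i'', ''v'', ''w'', ''H'', ''u'', ''k''}" "bds vertices_prog = {''n'', ''p''}" "wf_loop vertices_prog"
  "wr load_prog = {''i'', ''v'', ''w'', ''H'', ''u'', ''k'', ''a'', ''b'', ''f'', ''g''}"
  "bds load_prog = {''n'', ''p'', ''h'', ''r''}" "wf_loop load_prog"
  by (auto simp: layout_prog_def edges_prog_def vertices_prog_def load_prog_def)

lemma nth_default_append_plus: "length A = n \<Longrightarrow> nth_default d (A @ B) (n + i) = nth_default d B i"
  by (simp add: nth_default_append)

lemma input_memory_in: "input_memory xs ''in'' = nth_default 0 xs"
  by (auto simp: input_memory_def nth_default_def)

text \<open>The last equation skips to the appended word \<open>ys\<close>, so the same lemma serves
  for the second graph. The default 0 matches the empty cells of the input memory.\<close>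

lemma nth_default_graph_word:
  fixes vs ys :: "nat list" and es :: "(nat \<times> nat) list" and n h :: nat and rd :: "nat \<Rightarrow> nat"
  defines "n \<equiv> length vs" and "h \<equiv> length es" and "rd \<equiv> nth_default 0 (graph_word vs es @ ys)"
  shows "rd 0 = n" "rd (Suc 0) = h" "i < n \<Longrightarrow> rd (Suc (Suc i)) = vs ! i"
    "i < h \<Longrightarrow> rd (Suc (Suc (n + (i + i)))) = fst (es ! i)"
    "i < h \<Longrightarrow> rd (Suc (Suc (n + Suc (i + i)))) = snd (es ! i)"
    "rd (Suc (Suc (n + (h + h + i)))) = nth_default 0 ys i"
proof -
  show "rd 0 = n" "rd (Suc 0) = h" by (simp_all add: rd_def graph_word_def n_def h_def)
  show "i < n \<Longrightarrow> rd (Suc (Suc i)) = vs ! i"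
    by (simp add: rd_def graph_word_def n_def nth_default_append)
  have rd: "rd (Suc (Suc (n + j))) = nth_default 0 (pairs es @ ys) j" for j
    by (simp add: rd_def graph_word_def n_def nth_default_append_plus)
  show "i < h \<Longrightarrow> rd (Suc (Suc (n + (i + i)))) = fst (es ! i)"
    "i < h \<Longrightarrow> rd (Suc (Suc (n + Suc (i + i)))) = snd (es ! i)"
    unfolding rd by (simp_all add: h_def nth_default_append length_pairs nth_pairs)
  show "rd (Suc (Suc (n + (h + h + i)))) = nth_default 0 ys i"
    unfolding rd by (rule nth_default_append_plus) (simp add: length_pairs h_def)
qed

lemma den_edges_prog:
  assumes ne: "A \<notin> {B, ''i'', n, t, ''in''}" "B \<notin> {''i'', n, t, ''in''}" "n \<noteq> ''i''" "t \<noteq> ''i''"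
    and n: "s n 0 = length es"
    and rd: "\<And>i. i < length es \<Longrightarrow> s ''in'' (s t 0 + (i + i)) = fst (es ! i) \<and>
      s ''in'' (s t 0 + Suc (i + i)) = snd (es ! i)"
    and l: "l < length (sym_edges es)"
  defines "s' \<equiv> den (edges_prog n A B t) s"
  shows "s' A l = fst (sym_edges es ! l) \<and> s' B l = snd (sym_edges es ! l)"
proof -
  let ?N = "length es"
  let ?b = "Asg A (Var ''i'') (Read ''in'' (Plus (Var t) (Plus (Var ''i'') (Var ''i'')))) ;;
      Asg B (Var ''i'') (Read ''in'' (Plus (Var t) (Plus (Const 1) (Plus (Var ''i'') (Var ''i''))))) ;;
      Asg A (Plus (Var n) (Var ''i'')) (Read B (Var ''i'')) ;;
      Asg B (Plus (Var n) (Var ''i'')) (Read A (Var ''i''))"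
  have ne': "A \<noteq> B" "B \<noteq> A" "A \<noteq> ''i''" "''i'' \<noteq> A" "A \<noteq> n" "n \<noteq> A" "A \<noteq> t" "t \<noteq> A" "A \<noteq> ''in''" "''in'' \<noteq> A"
    "B \<noteq> ''i''" "''i'' \<noteq> B" "B \<noteq> n" "n \<noteq> B" "B \<noteq> t" "t \<noteq> B" "B \<noteq> ''in''" "''in'' \<noteq> B"
    "n \<noteq> ''i''" "''i'' \<noteq> n" "t \<noteq> ''i''" "''i'' \<noteq> t"
    using ne by auto
  let ?I = "\<lambda>i s'. \<forall>j < i. s' A j = fst (es ! j) \<and> s' B j = snd (es ! j) \<and>
    s' A (?N + j) = snd (es ! j) \<and> s' B (?N + j) = fst (es ! j)"
  have I: "?I (s n 0) s'"
    unfolding s'_def edges_prog_def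
  proof (rule for_inv[where I = ?I])
    fix i s' assume i: "i < s n 0" "s' ''i'' 0 = i"
      and fr: "\<And>z. z \<notin> wr (For ''i'' n ?b) \<Longrightarrow> s' z = s z" and I: "?I i s'"
    have e: "s' n = s n" "s' t = s t" "s' ''in'' = s ''in''" by (rule fr; use ne' in simp)+
    have len: "i < ?N" using i n by simp
    define w where "w = den ?b s'"
    have w: "w A = (s' A)(i := fst (es ! i), ?N + i := snd (es ! i))"
      "w B = (s' B)(i := snd (es ! i), ?N + i := fst (es ! i))"
      unfolding w_def using len rd[OF len] n i(2) by (auto simp: ne' e)
    have "?I (Suc i) w" using I len by (auto simp: w less_Suc_eq)
    then show "?I (Suc i) (put ''i'' (Suc i) (den ?b s'))" unfolding w_def by (simp add: ne' del: den.simps)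
  qed simp
  show ?thesis
  proof (cases "l < ?N")
    case True
    then show ?thesis using I n by (simp add: sym_edges_def nth_append)
  next
    case False
    define j where "j = l - ?N"
    have "l = ?N + j" "j < ?N" using False l by (auto simp: j_def sym_edges_def)
    then show ?thesis using I n by (simp add: sym_edges_def nth_append)
  qed
qed

lemma den_vertices_prog:
  assumes n: "s ''n'' 0 = length vs" "\<And>i. i < length vs \<Longrightarrow> s ''in'' (Suc (Suc i)) = vs ! i"
    and p: "s ''p'' 0 = length ws" "\<And>i. i < length ws \<Longrightarrow> s ''in'' (s ''S'' 0 + i) = ws ! i"
    and z: "\<And>v. s ''H'' v = 0" "s ''k'' 0 = 0"
  defines "s' \<equiv> den vertices_prog s" and "us \<equiv> filter (\<lambda>v. v \<notin> set ws) vs"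
  shows "\<forall>i < length vs. s' ''v'' i = vs ! i" "\<forall>i < length ws. s' ''w'' i = ws ! i"
    "s' ''k'' 0 = length us" "\<forall>i < length us. s' ''u'' i = us ! i"
proof -
  let ?a = "Asg ''v'' (Var ''i'') (Read ''in'' (Plus (Const 2) (Var ''i'')))"
  let ?b = "Asg ''w'' (Var ''i'') (Read ''in'' (Plus (Var ''S'') (Var ''i''))) ;;
       Asg ''H'' (Read ''w'' (Var ''i'')) (Const 1)"
  let ?t = "Equal (Read ''H'' (Read ''v'' (Var ''i''))) (Const 0)"
  let ?u = "Asg ''u'' (Var ''k'') (Read ''v'' (Var ''i'')) ;; Set ''k'' (Plus (Var ''k'') (Const 1))"
  define s1 where "s1 = den (For ''i'' ''n'' ?a) s"
  define s2 where "s2 = den (For ''i'' ''p'' ?b) s1"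
  have e: "s' = den (For ''i'' ''n'' (Cond ?t ?u)) s2"
    by (simp only: s'_def s1_def s2_def vertices_prog_def den.simps(2))
  have fr1: "s1 z = s z" if "z \<notin> {''i'', ''v''}" for z using that unfolding s1_def by (intro den_frame) auto
  have fr2: "s2 z = s1 z" if "z \<notin> {''i'', ''w'', ''H''}" for z using that unfolding s2_def by (intro den_frame) auto
  have fr3: "s' z = s2 z" if "z \<notin> {''i'', ''u'', ''k''}" for z using that unfolding e by (intro den_frame) auto
  let ?I = "\<lambda>i t. \<forall>j < i. t ''v'' j = vs ! j"
  have I: "?I (s ''n'' 0) s1"
    unfolding s1_def
  proof (rule for_inv[where I = ?I])
    fix i t assume "i < s ''n'' 0" "t ''i'' 0 = i" "\<And>z. z \<notin> wr (For ''i'' ''n'' ?a) \<Longrightarrow> t z = s z" "?I i t"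
    then show "?I (Suc i) (put ''i'' (Suc i) (den ?a t))" using n by (simp add: less_Suc_eq)
  qed simp
  let ?J = "\<lambda>i t. (\<forall>j < i. t ''w'' j = ws ! j) \<and> (\<forall>v. t ''H'' v = of_bool (v \<in> set (take i ws)))"
  have J: "?J (s1 ''p'' 0) s2"
    unfolding s2_def
  proof (rule for_inv[where I = ?J])
    show "?J 0 (put ''i'' 0 s1)" using z by (simp add: fr1)
    fix i t assume i: "i < s1 ''p'' 0" "t ''i'' 0 = i"
      and fr: "\<And>z. z \<notin> wr (For ''i'' ''p'' ?b) \<Longrightarrow> t z = s1 z" and J: "?J i t"
    have len: "i < length ws" using i p by (simp add: fr1)
    have tk: "set (take (Suc i) ws) = insert (ws ! i) (set (take i ws))"
      using len by (simp add: take_Suc_conv_app_nth)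
    define w where "w = den ?b t"
    have w: "w ''w'' = (t ''w'')(i := ws ! i)" "w ''H'' = (t ''H'')(ws ! i := 1)"
      unfolding w_def using i p(2)[OF len] by (auto simp: fr fr1)
    have "?J (Suc i) w" unfolding w tk using J by (auto simp: less_Suc_eq)
    then show "?J (Suc i) (put ''i'' (Suc i) (den ?b t))" unfolding w_def by (simp del: den.simps)
  qed
  have v2: "s2 ''v'' j = vs ! j" if "j < length vs" for j using that I n by (simp add: fr2)
  have H2: "s2 ''H'' v = of_bool (v \<in> set ws)" for v using J p by (simp add: fr1)
  let ?us = "\<lambda>i. filter (\<lambda>v. v \<notin> set ws) (take i vs)"
  let ?K = "\<lambda>i t. t ''k'' 0 = length (?us i) \<and> (\<forall>j < length (?us i). t ''u'' j = ?us i ! j)"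
  have K: "?K (s2 ''n'' 0) s'"
    unfolding e
  proof (rule for_inv[where I = ?K])
    show "?K 0 (put ''i'' 0 s2)" using z by (simp add: fr1 fr2)
    fix i t assume i: "i < s2 ''n'' 0" "t ''i'' 0 = i"
      and fr: "\<And>z. z \<notin> wr (For ''i'' ''n'' (Cond ?t ?u)) \<Longrightarrow> t z = s2 z" and K: "?K i t"
    have len: "i < length vs" using i n by (simp add: fr1 fr2)
    have test: "bval ?t t \<longleftrightarrow> vs ! i \<notin> set ws" using i v2[OF len] H2 by (simp add: fr)
    define us where "us = ?us i"
    have K': "t ''k'' 0 = length us" "\<forall>j < length us. t ''u'' j = us ! j" using K unfolding us_def by blast+
    define w where "w = den (Cond ?t ?u) t"
    have us: "?us (Suc i) = (if vs ! i \<in> set ws then us else us @ [vs ! i])"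
      using len by (simp add: us_def take_Suc_conv_app_nth)
    have "?K (Suc i) w"
    proof (cases "vs ! i \<in> set ws")
      case True
      then have "w = t" unfolding w_def den.simps(3) test by simp
      then show ?thesis unfolding us using True K' by simp
    next
      case False
      then have "w ''k'' 0 = Suc (length us)" "w ''u'' = (t ''u'')(length us := vs ! i)"
        unfolding w_def den.simps(3) test using i v2[OF len] K' by (simp_all add: fr)
      then show ?thesis unfolding us using False K' by (simp add: nth_append less_Suc_eq)
    qed
    then show "?K (Suc i) (put ''i'' (Suc i) (den (Cond ?t ?u) t))" unfolding w_def by (simp del: den.simps)
  qed
  have n2: "s2 ''n'' 0 = length vs" using n by (simp add: fr1 fr2)
  show "\<forall>i < length vs. s' ''v'' i = vs ! i" using v2 by (simp add: fr3)
  show "\<forall>i < length ws. s' ''w'' i = ws ! i" using J p by (simp add: fr1 fr3)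
  show "s' ''k'' 0 = length us" "\<forall>i < length us. s' ''u'' i = us ! i"
    using K unfolding n2 us_def by simp_all
qed

lemma loaded_input:
  fixes vs ws :: "nat list" and es fs :: "(nat \<times> nat) list"
  defines "s0 \<equiv> den layout_prog (input_memory (graph_word vs es @ graph_word ws fs))"
  shows "loaded vs (sym_edges es) ws (sym_edges fs) (den load_prog s0)"
    and "s0 ''n'' 0 = length vs" "s0 ''h'' 0 = length es" "s0 ''p'' 0 = length ws" "s0 ''r'' 0 = length fs"
proof -
  let ?xs = "graph_word vs es @ graph_word ws fs"
  let ?rd = "nth_default 0 ?xs"
  let ?n = "length vs" and ?h = "length es" and ?p = "length ws" and ?r = "length fs"
  let ?o = "Suc (Suc (?n + (?h + ?h)))"
  note G = nth_default_graph_word[where vs = vs and es = es and ys = "graph_word ws fs"]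
  note H = nth_default_graph_word[where vs = ws and es = fs and ys = "[]", simplified]
  have rd: "?rd (?o + j) = nth_default 0 (graph_word ws fs) j" for j
    using G(6)[of j] by (simp add: add.assoc)
  have o: "?rd ?o = ?p" "?rd (Suc ?o) = ?r"
    using rd[of 0] rd[of 1] H(1,2) by simp_all
  have s0: "s0 ''n'' 0 = ?n" "s0 ''h'' 0 = ?h" "s0 ''m'' 0 = ?h + ?h" "s0 ''t'' 0 = Suc (Suc ?n)"
    "s0 ''p'' 0 = ?p" "s0 ''r'' 0 = ?r" "s0 ''q'' 0 = ?r + ?r" "s0 ''S'' 0 = Suc (Suc ?o)" "s0 ''T'' 0 = Suc (Suc ?o) + ?p"
    using G(1,2) o by (simp_all add: s0_def layout_prog_def input_memory_in)
  have fr0: "s0 z = input_memory ?xs z" if "z \<notin> wr layout_prog" for z using that unfolding s0_def by (rule den_frame)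
  show "s0 ''n'' 0 = length vs" "s0 ''h'' 0 = length es" "s0 ''p'' 0 = length ws" "s0 ''r'' 0 = length fs"
    by (rule s0)+
  define s1 where "s1 = den vertices_prog s0"
  define s2 where "s2 = den (edges_prog ''h'' ''a'' ''b'' ''t'') s1"
  define s3 where "s3 = den (edges_prog ''r'' ''f'' ''g'' ''T'') s2"
  have e: "den load_prog s0 = s3" by (simp only: load_prog_def s1_def s2_def s3_def den.simps(2))
  have fr1: "s1 z = s0 z" if "z \<notin> {''i'', ''v'', ''w'', ''H'', ''u'', ''k''}" for z
    using that by (simp add: s1_def den_frame)
  have fr2: "s2 z = s1 z" if "z \<notin> {''i'', ''a'', ''b''}" for z using that by (simp add: s2_def den_frame)
  have fr3: "s3 z = s2 z" if "z \<notin> {''i'', ''f'', ''g''}" for z using that by (simp add: s3_def den_frame)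
  have inp: "s0 ''in'' = ?rd" by (simp add: fr0 input_memory_in)
  have w: "s0 ''in'' (s0 ''S'' 0 + i) = ws ! i" if "i < ?p" for i
    using rd[of "Suc (Suc i)"] H(3)[of i] that by (simp add: inp s0)
  have v: "s0 ''in'' (Suc (Suc i)) = vs ! i" if "i < ?n" for i using G(3) that by (simp add: inp)
  have z: "s0 ''H'' v = 0" "s0 ''k'' 0 = 0" for v by (simp_all add: fr0 input_memory_def)
  note V = den_vertices_prog[of s0 vs ws, OF s0(1) v s0(5) w z, folded s1_def]
  have E1: "s2 ''a'' l = fst (sym_edges es ! l) \<and> s2 ''b'' l = snd (sym_edges es ! l)" if "l < length (sym_edges es)" for l
    unfolding s2_def using that G(4,5) by (intro den_edges_prog) (auto simp: fr1 s0 inp)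
  have E2: "s3 ''f'' l = fst (sym_edges fs ! l) \<and> s3 ''g'' l = snd (sym_edges fs ! l)" if "l < length (sym_edges fs)" for l
  proof -
    have "?rd (Suc (Suc (Suc (Suc (?n + (?h + ?h) + ?p + (i + i)))))) = fst (fs ! i)"
      "?rd (Suc (Suc (Suc (Suc (?n + (?h + ?h) + ?p + Suc (i + i)))))) = snd (fs ! i)" if "i < ?r" for i
      using rd[of "Suc (Suc (?p + (i + i)))"] rd[of "Suc (Suc (?p + Suc (i + i)))"] H(4,5)[OF that]
      by (simp_all add: add.assoc)
    then show ?thesis
      unfolding s3_def using that by (intro den_edges_prog) (auto simp: fr2 fr1 s0 inp)
  qed
  show "loaded vs (sym_edges es) ws (sym_edges fs) (den load_prog s0)"
    unfolding loaded_def e using V E1 E2 by (simp add: fr3 fr2 fr1 s0) (simp add: sym_edges_def)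
qed

text \<open>No pair occurs in both orientations in \<open>es\<close>, since each edge is listed once
  and is not a loop; so doubling creates no repetition. The length bound makes all loops over edges
  polynomial.\<close>

lemma sym_edges:
  assumes "simple_graph G" "distinct (map (\<lambda>(u, v). {u, v}) es)" "set (map (\<lambda>(u, v). {u, v}) es) = edges G"
  shows "distinct (sym_edges es)" "set (sym_edges es) = {(a, b). {a, b} \<in> edges G}"
    "length (sym_edges es) \<le> card (verts G) * card (verts G)"
proof -
  let ?f = "\<lambda>(u, v). {u, v}"
  have es: "distinct es" "inj_on ?f (set es)" "?f ` set es = edges G"
    using assms by (auto simp: distinct_map)
  have "set es \<inter> prod.swap ` set es = {}"
  proof -
    have False if "(a, b) \<in> set es" "(b, a) \<in> set es" for a b
    proof -
      have "(a, b) = (b, a)" by (rule inj_onD[OF es(2)]) (use that in auto)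
      moreover have "{a, b} \<in> edges G" using that(1) es(3) by force
      ultimately show False using simple_graph_edgeD(3)[OF assms(1)] by blast
    qed
    then show ?thesis by auto
  qed
  then show dist: "distinct (sym_edges es)"
    using es(1) by (simp add: sym_edges_def distinct_map)
  show set: "set (sym_edges es) = {(a, b). {a, b} \<in> edges G}"
  proof (intro set_eqI iffI)
    fix e assume "e \<in> set (sym_edges es)"
    then show "e \<in> {(a, b). {a, b} \<in> edges G}"
      using es(3) by (force simp: sym_edges_def insert_commute)
  next
    fix e assume "e \<in> {(a, b). {a, b} \<in> edges G}"
    then obtain a b where e: "e = (a, b)" "{a, b} \<in> edges G" by auto
    then have "{a, b} \<in> ?f ` set es" using es(3) by simp
    then obtain p where p: "{a, b} = ?f p" "p \<in> set es" by (rule imageE)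
    obtain u v where "p = (u, v)" by force
    with p have uv: "(u, v) \<in> set es" "{a, b} = {u, v}" by auto
    then have "e = (u, v) \<or> e = prod.swap (u, v)" using e by (auto simp: doubleton_eq_iff)
    then show "e \<in> set (sym_edges es)" using uv(1) unfolding sym_edges_def by auto
  qed
  have "finite (verts G)" using assms by (simp add: simple_graph_def)
  moreover have "set (sym_edges es) \<subseteq> verts G \<times> verts G"
    unfolding set using simple_graph_edgeD[OF assms(1)] by blast
  ultimately have "card (set (sym_edges es)) \<le> card (verts G \<times> verts G)" by (intro card_mono) auto
  then show "length (sym_edges es) \<le> card (verts G) * card (verts G)"
    using dist by (simp add: distinct_card card_cartesian_product)
qed

section \<open>The complete program and its running time\<close>

definition pre_power_prog :: loop where
  "pre_power_prog = Set ''E'' (Plus (Var ''d'') (Const 1)) ;; Set ''P'' (Const 1)"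

definition total_prog :: loop where
  "total_prog = Set ''N'' (Read ''P'' (Var ''k''))"

lemma total_simps [simp]:
  "wr pre_power_prog = {''E'', ''P''}" "bds pre_power_prog = {}" "wf_loop pre_power_prog"
  "wr total_prog = {''N''}" "bds total_prog = {}" "wf_loop total_prog"
  by (auto simp: pre_power_prog_def total_prog_def)

definition solver :: com where
  "solver = Seq (compile layout_prog) (Seq (compile load_prog) (Seq (compile order_prog)
     (Seq (compile pre_power_prog) (Seq (compile power_prog) (Seq (compile total_prog) (compile main_prog))))))"

lemma exec_Seq_le:
  assumes "\<exists>t\<le>T1. exec c1 s t s1" "\<exists>t\<le>T2. exec c2 s1 t s2"
  shows "\<exists>t\<le>T1 + T2. exec (Seq c1 c2) s t s2"
  using assms exec.Seq by (meson add_mono)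

definition prep_time :: "nat \<Rightarrow> nat" where
  "prep_time M = tb layout_prog (\<lambda>_. M) + tb load_prog (\<lambda>_. M) + tb order_prog (\<lambda>_. M) +
     tb pre_power_prog (\<lambda>_. M) + tb power_prog (\<lambda>_. M) + tb total_prog (\<lambda>_. M)"

text \<open>\<open>M\<close> bounds every loop limit except \<open>N\<close>: there are at most
  \<open>n * n\<close> oriented edges, and the extra 1 is for the limit \<open>E\<close>, which is
  \<open>d + 1\<close>. The 21 collects the loop overheads 9 and 12 of the main loop.\<close>

lemma solver_correct:
  assumes G: "simple_graph G" and H: "simple_graph H" and sub: "verts H \<subseteq> verts G"
    and xs: "encodes_instance xs G H"
  defines "M \<equiv> card (verts G) * card (verts G) + 1"
  shows "answers_within solver xs (labeled_contraction_of H G)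
    ((degeneracy H + 1) ^ card (verts G - verts H) * (prep_time M + (21 + tb body_prog (\<lambda>_. M))))"
proof -
  obtain vs es ws fs where
    vs: "distinct vs" "set vs = verts G" and es: "distinct (map (\<lambda>(u, v). {u, v}) es)"
      "set (map (\<lambda>(u, v). {u, v}) es) = edges G" and
    ws: "distinct ws" "set ws = verts H" and fs: "distinct (map (\<lambda>(u, v). {u, v}) fs)"
      "set (map (\<lambda>(u, v). {u, v}) fs) = edges H" and
    xs': "xs = graph_word vs es @ graph_word ws fs"
    using xs unfolding encodes_instance_def encodes_graph_def graph_word_def pairs_def by metis
  note E = sym_edges[OF G es] and F = sym_edges[OF H fs]
  interpret instance_lists G H vs ws "sym_edges es" "sym_edges fs"
    by unfold_locales (use G H sub vs ws E F in auto)
  define n where "n = card (verts G)"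
  have fin: "finite (verts G)" using G by (simp add: simple_graph_def)
  have lv: "length vs = n" using vs by (simp add: n_def distinct_card flip: vs(2))
  have pn: "card (verts H) \<le> n" using sub fin by (simp add: n_def card_mono)
  have lw: "length ws \<le> n" using ws pn by (simp add: distinct_card flip: ws(2))
  have lE: "length (sym_edges es) \<le> n * n" using E(3) by (simp add: n_def)
  have lF: "length (sym_edges fs) \<le> n * n" using F(3) mult_le_mono[OF pn pn] by simp
  have M: "M = n * n + 1" by (simp add: M_def n_def)
  have nM: "n \<le> M" by (simp add: M le_SucI)
  define k where "k = card (verts G - verts H)"
  have "set others = verts G - verts H" using vs ws by auto
  then have k: "length others = k" unfolding k_def using vs by (metis distinct_card distinct_filter)
  have kn: "k \<le> n" unfolding k_def n_def using fin by (intro card_mono) auto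
  define s0 where "s0 = den layout_prog (input_memory xs)"
  define s1 where "s1 = den load_prog s0"
  define s2 where "s2 = den order_prog s1"
  define s3 where "s3 = den pre_power_prog s2"
  define s4 where "s4 = den power_prog s3"
  define s5 where "s5 = den total_prog s4"
  define s6 where "s6 = den main_prog s5"
  have fr0: "s0 z = input_memory xs z" if "z \<notin> wr layout_prog" for z using that unfolding s0_def by (rule den_frame)
  have fr1: "s1 z = s0 z" if "z \<notin> wr load_prog" for z using that unfolding s1_def by (rule den_frame)
  have fr2: "s2 z = s1 z" if "z \<notin> wr order_prog" for z using that unfolding s2_def by (rule den_frame)
  have fr3: "s3 z = s2 z" if "z \<notin> wr pre_power_prog" for z using that unfolding s3_def by (rule den_frame)
  have fr4: "s4 z = s3 z" if "z \<notin> wr power_prog" for z using that unfolding s4_def by (rule den_frame)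
  have fr5: "s5 z = s4 z" if "z \<notin> wr total_prog" for z using that unfolding s5_def by (rule den_frame)
  note L = loaded_input[of vs es ws fs, folded xs', folded s0_def, folded s1_def]
  have len1: "s1 ''n'' 0 = length vs" "s1 ''m'' 0 = length (sym_edges es)" "s1 ''p'' 0 = length ws"
    "s1 ''q'' 0 = length (sym_edges fs)" "s1 ''k'' 0 = k"
    using L(1) k by (simp_all add: loaded_def)
  have z: "s5 z v = 0" if "z \<in> {''C'', ''R'', ''out''}" for z v
    using that by (auto simp: fr5 fr4 fr3 fr2 fr1 fr0 input_memory_def)
  have "s1 ''X'' h = 0" "s1 ''d'' 0 = 0" for h by (simp_all add: fr1 fr0 input_memory_def)
  from den_order_prog[OF L(1) this] obtain X where X: "ordered X s2" "elimination_order X (s2 ''d'' 0)"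
    "s2 ''d'' 0 \<le> degeneracy H" "s2 ''d'' 0 \<le> length (sym_edges fs)" unfolding s2_def[symmetric] by blast
  define d where "d = s2 ''d'' 0"
  \<comment> \<open>The degeneracy bound is not what is used here: the width is at most the number
    of oriented edges of \<open>H\<close>.\<close>
  have dM: "Suc d \<le> M" using X(4) lF by (simp add: d_def M)
  have s3: "s3 ''E'' 0 = Suc d" "s3 ''P'' 0 = 1" "s3 ''k'' 0 = k"
    using len1 by (simp_all add: s3_def pre_power_prog_def d_def fr2)
  have P: "s4 ''P'' j = Suc d ^ j" if "j \<le> k" for j
    using den_power_prog[of s3 j] s3 that unfolding s4_def by (simp del: den.simps)
  have k4: "s4 ''k'' 0 = k" using s3 by (simp add: fr4)
  have N: "s5 ''N'' 0 = Suc d ^ k" using P[of k] k4 by (simp add: s5_def total_prog_def)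
  have k5: "s5 ''k'' 0 = k" "s5 ''d'' 0 = d" using k4 by (simp_all add: fr5 fr4 fr3 d_def)
  have P5: "s5 ''P'' j = Suc d ^ j" if "j \<le> k" for j using P[OF that] by (simp add: fr5)
  have l5: "loaded_mem s5" using L(1) by (subst loaded_cong[of _ s1]) (auto simp: fr5 fr4 fr3 fr2)
  have o5: "ordered X s5" using X(1) by (simp add: ordered_def fr5 fr4 fr3)
  have "s6 ''out'' 0 = of_bool (\<exists>\<phi>. contraction_map G H \<phi>)"
    unfolding s6_def
    by (rule den_main_prog[OF l5 o5, of d]) (use X(2) k5 P5 N z in \<open>auto simp: d_def\<close>)
  then have out: "s6 ''out'' 0 = of_bool (labeled_contraction_of H G)"
    by (simp add: labeled_contraction_iff[OF G H])

  let ?M = "\<lambda>_::string. M"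
  have bounds: "length vs \<le> M" "length ws \<le> M" "length (sym_edges es) \<le> M" "length (sym_edges fs) \<le> M"
    "k \<le> M" "length es \<le> M" "length fs \<le> M"
    using lv lw lE lF kn nM by (auto simp: M sym_edges_def)
  have x0: "\<exists>t\<le>tb layout_prog ?M. exec (compile layout_prog) (input_memory xs) t s0"
    unfolding s0_def by (rule exec_compile) auto
  have x1: "\<exists>t\<le>tb load_prog ?M. exec (compile load_prog) s0 t s1"
    unfolding s1_def by (rule exec_compile) (use L bounds in auto)
  have x2: "\<exists>t\<le>tb order_prog ?M. exec (compile order_prog) s1 t s2"
    unfolding s2_def by (rule exec_compile) (use len1 bounds in auto)
  have x3: "\<exists>t\<le>tb pre_power_prog ?M. exec (compile pre_power_prog) s2 t s3"
    unfolding s3_def by (rule exec_compile) auto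
  have x4: "\<exists>t\<le>tb power_prog ?M. exec (compile power_prog) s3 t s4"
    unfolding s4_def by (rule exec_compile) (use s3 bounds dM in auto)
  have x5: "\<exists>t\<le>tb total_prog ?M. exec (compile total_prog) s4 t s5"
    unfolding s5_def by (rule exec_compile) auto
  let ?L = "?M(''N'' := Suc d ^ k)"
  have len5: "s5 z = s1 z" if "z \<in> {''n'', ''m'', ''p'', ''q''}" for z
    using that by (auto simp: fr5 fr4 fr3 fr2)
  have x6: "\<exists>t\<le>tb main_prog ?L. exec (compile main_prog) s5 t s6"
    unfolding s6_def
  proof (rule exec_compile)
    fix y assume "y \<in> bds main_prog"
    then consider "y = ''N''" | "y = ''k''" | "y = ''d''" | "y \<in> {''n'', ''m'', ''p'', ''q''}" by auto
    then show "s5 y 0 \<le> ?L y"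
    proof cases
      case 4
      then show ?thesis using len5[OF 4] len1 bounds by auto
    qed (use N k5 bounds dM in auto)
  qed auto
  \<comment> \<open>\<open>N\<close> limits only the outermost loop, so inside the body the
    exponential bound does not appear.\<close>
  have "tb body_prog ?L = tb body_prog ?M" by (rule tb_cong) auto
  then have T6: "tb main_prog ?L = 9 + Suc d ^ k * (12 + tb body_prog ?M)" by (simp add: main_prog_def)
  have "\<exists>t\<le>tb layout_prog ?M + (tb load_prog ?M + (tb order_prog ?M + (tb pre_power_prog ?M +
      (tb power_prog ?M + (tb total_prog ?M + tb main_prog ?L))))). exec solver (input_memory xs) t s6"
    unfolding solver_def by (intro exec_Seq_le[OF x0] exec_Seq_le[OF x1] exec_Seq_le[OF x2]
        exec_Seq_le[OF x3] exec_Seq_le[OF x4] exec_Seq_le[OF x5] x6)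
  then obtain t where t: "t \<le> prep_time M + tb main_prog ?L" "exec solver (input_memory xs) t s6"
    unfolding prep_time_def by (auto simp: add.assoc)
  let ?D = "(degeneracy H + 1) ^ k"
  have "Suc d ^ k \<le> ?D" using X(3) by (intro power_mono) (auto simp: d_def)
  then have "Suc d ^ k * (12 + tb body_prog ?M) \<le> ?D * (12 + tb body_prog ?M)" by (rule mult_right_mono) simp
  \<comment> \<open>The exponential factor is at least 1 and absorbs the additive terms.\<close>
  moreover have "prep_time M + 9 \<le> ?D * (prep_time M + 9)" by simp
  ultimately have "t \<le> ?D * (prep_time M + 9) + ?D * (12 + tb body_prog ?M)" using t(1) T6 by linarith
  also have "\<dots> = ?D * (prep_time M + (21 + tb body_prog ?M))" by (simp add: algebra_simps)
  finally show ?thesis using t(2) out unfolding answers_within_def k_def by blast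
qed

theorem theorem4:
  shows "\<exists>(p :: com) (q :: nat poly). \<forall>(G :: nat graph) (H :: nat graph) xs.
    simple_graph G \<and> simple_graph H \<and> verts H \<subseteq> verts G \<and> encodes_instance xs G H \<longrightarrow>
    answers_within p xs (labeled_contraction_of H G)
      ((degeneracy H + 1) ^ card (verts G - verts H) * poly q (card (verts G)))"
proof -
  obtain q1 where q1: "\<And>M. tb layout_prog (\<lambda>_. M) = poly q1 M" using tb_poly by blast
  obtain q2 where q2: "\<And>M. tb load_prog (\<lambda>_. M) = poly q2 M" using tb_poly by blast
  obtain q3 where q3: "\<And>M. tb order_prog (\<lambda>_. M) = poly q3 M" using tb_poly by blast
  obtain q4 where q4: "\<And>M. tb pre_power_prog (\<lambda>_. M) = poly q4 M" using tb_poly by blast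
  obtain q5 where q5: "\<And>M. tb power_prog (\<lambda>_. M) = poly q5 M" using tb_poly by blast
  obtain q6 where q6: "\<And>M. tb total_prog (\<lambda>_. M) = poly q6 M" using tb_poly by blast
  obtain q7 where q7: "\<And>M. tb body_prog (\<lambda>_. M) = poly q7 M" using tb_poly by blast
  \<comment> \<open>The inner polynomial \<open>[:1, 0, 1:]\<close> is the bound
    \<open>n * n + 1\<close> on the polynomial loop limits.\<close>
  let ?q = "pcompose (q1 + q2 + q3 + q4 + q5 + q6 + ([:21:] + q7)) [:1, 0, 1:]"
  have "poly ?q n = prep_time (n * n + 1) + (21 + tb body_prog (\<lambda>_. n * n + 1))" for n
    by (simp add: poly_pcompose prep_time_def q1 q2 q3 q4 q5 q6 q7)
  then show ?thesis using solver_correct by metis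
qed

end
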